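(* Let $SB_3$ be the singular braid group on $3$ strands and let $ST_3$ be the kernel of the homomorphism $\pi: SB_3\to S_3$ given by $\pi(\sigma_i)=(i,i+1)$, $\pi(\tau_i)=1$ for $i=1,2$. With the elements $a_{ij},c_{ij}\in ST_3$ defined in the context, the group $ST_3$ is the semi-direct product of the normal subgroup $H$ generated by $a_{13},a_{23},c_{12},c_{13},c_{23}$, which has in these generators the presentation $$H=\langle a_{13},a_{23},c_{12},c_{13},c_{23}\ |\ a_{13}c_{13}=c_{13}a_{13},\ a_{23}c_{23}=c_{23}a_{23},\ c_{12}a_{13}a_{23}c_{12}^{-1}=a_{13}a_{23}\rangle,$$ and the infinite cyclic group $U_2=\langle a_{12}\rangle$. Moreover, the group $H$ is an HNN extension of $$\mathbb{Z}^2*\mathbb{Z}^2\simeq\langle a_{13},a_{23},c_{13},c_{23}\ |\ a_{13}c_{13}=c_{13}a_{13},\ a_{23}c_{23}=c_{23}a_{23}\rangle$$ with stable letter $c_{12}$, associated subgroups $A=B=\langle a_{13}a_{23}\rangle$ and identity isomorphism $A\to B$.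
   Context: The singular braid group $SB_3$ is the group generated by $\sigma_1,\sigma_2,\tau_1,\tau_2$ with defining relations $$\sigma_1\sigma_2\sigma_1=\sigma_2\sigma_1\sigma_2,\quad \sigma_1\tau_1=\tau_1\sigma_1,\quad \sigma_2\tau_2=\tau_2\sigma_2,\quad \sigma_1\sigma_2\tau_1=\tau_2\sigma_1\sigma_2,\quad \sigma_2\sigma_1\tau_2=\tau_1\sigma_2\sigma_1.$$ $S_3$ is the symmetric group on $3$ symbols and $(i,i+1)$ denotes the transposition. The following elements of $SB_3$ lie in $ST_3$: $$a_{12}=\sigma_1^2,\quad a_{23}=\sigma_2^2,\quad a_{13}=\sigma_2\sigma_1^2\sigma_2^{-1},\quad c_{12}=\tau_1,\quad c_{23}=\tau_2,\quad c_{13}=\sigma_2\tau_1\sigma_2^{-1}.$$ *)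

theory Defs
  imports "HOL-Algebra.Algebra"
begin

section \<open>Groups given by generators and relations\<close>

text \<open>
  The library has no non-abelian free groups, so presented groups are built directly:
  words in letters \<open>x\<close> and \<open>x\<inverse>\<close> (\<open>x \<in> S\<close>) modulo the least congruence that contains the
  relations and makes \<open>x\<close> and \<open>x\<inverse>\<close> mutually inverse.  A relation is a pair of words
  \<open>(u, v)\<close>, read \<open>u = v\<close>; pairs that are not words over \<open>S\<close> are ignored.
\<close>

type_synonym 'x letter = "'x \<times> bool"

abbreviation pos :: "'x \<Rightarrow> 'x letter" where "pos x \<equiv> (x, True)"
abbreviation neg :: "'x \<Rightarrow> 'x letter" where "neg x \<equiv> (x, False)"

definition words :: "'x set \<Rightarrow> 'x letter list set" where
  "words S = lists (S \<times> UNIV)"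

inductive pres_eq ::
    "'x set \<Rightarrow> ('x letter list \<times> 'x letter list) set \<Rightarrow> 'x letter list \<Rightarrow> 'x letter list \<Rightarrow> bool"
  for S R where
  refl: "u \<in> words S \<Longrightarrow> pres_eq S R u u"
| sym: "pres_eq S R u v \<Longrightarrow> pres_eq S R v u"
| trans: "pres_eq S R u v \<Longrightarrow> pres_eq S R v w \<Longrightarrow> pres_eq S R u w"
| append: "pres_eq S R u u' \<Longrightarrow> pres_eq S R v v' \<Longrightarrow> pres_eq S R (u @ v) (u' @ v')"
| cancel: "x \<in> S \<Longrightarrow> pres_eq S R [(x, b), (x, \<not> b)] []"
| rel: "(u, v) \<in> R \<Longrightarrow> u \<in> words S \<Longrightarrow> v \<in> words S \<Longrightarrow> pres_eq S R u v"

definition pres_class ::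
    "'x set \<Rightarrow> ('x letter list \<times> 'x letter list) set \<Rightarrow> 'x letter list \<Rightarrow> 'x letter list set" where
  "pres_class S R w = {v. pres_eq S R w v}"

definition presented_group ::
    "'x set \<Rightarrow> ('x letter list \<times> 'x letter list) set \<Rightarrow> 'x letter list set monoid" where
  "presented_group S R =
     \<lparr>carrier = pres_class S R ` words S,
      monoid.mult = (\<lambda>A B. {w. \<exists>u\<in>A. \<exists>v\<in>B. pres_eq S R (u @ v) w}),
      one = pres_class S R []\<rparr>"

definition pres_gen ::
    "'x set \<Rightarrow> ('x letter list \<times> 'x letter list) set \<Rightarrow> 'x \<Rightarrow> 'x letter list set" where
  "pres_gen S R x = pres_class S R [pos x]"

text \<open>\<open>G\<close> has, in the elements \<open>f x\<close> (\<open>x \<in> S\<close>), the presentation \<open>\<langle>S | R\<rangle>\<close>.\<close>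

definition has_presentation ::
    "('g, 'm) monoid_scheme \<Rightarrow> 'x set \<Rightarrow> ('x \<Rightarrow> 'g) \<Rightarrow> ('x letter list \<times> 'x letter list) set \<Rightarrow> bool" where
  "has_presentation G S f R \<longleftrightarrow>
     (\<exists>\<phi> \<in> iso (presented_group S R) G. \<forall>x\<in>S. \<phi> (pres_gen S R x) = f x)"


section \<open>Free products, HNN extensions, semidirect products\<close>

definition table_rels ::
    "('g, 'm) monoid_scheme \<Rightarrow> ('g \<Rightarrow> 'x) \<Rightarrow> ('x letter list \<times> 'x letter list) set" where
  "table_rels G \<iota> = {([pos (\<iota> g), pos (\<iota> h)], [pos (\<iota> (g \<otimes>\<^bsub>G\<^esub> h))]) | g h.
      g \<in> carrier G \<and> h \<in> carrier G}"

definition free_product ::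
    "('g, 'm) monoid_scheme \<Rightarrow> ('h, 'n) monoid_scheme \<Rightarrow> ('g + 'h) letter list set monoid" where
  "free_product G H =
     presented_group (Inl ` carrier G \<union> Inr ` carrier H) (table_rels G Inl \<union> table_rels H Inr)"

text \<open>
  The HNN extension \<open>\<langle>G, t | t a t\<inverse> = \<phi> a (a \<in> A)\<rangle>\<close>: generators are all elements of \<open>G\<close>
  (as \<open>Inl g\<close>) and the stable letter \<open>t = Inr ()\<close>.
\<close>

definition hnn_gens :: "('g, 'm) monoid_scheme \<Rightarrow> ('g + unit) set" where
  "hnn_gens G = insert (Inr ()) (Inl ` carrier G)"

definition hnn_rels ::
    "('g, 'm) monoid_scheme \<Rightarrow> 'g set \<Rightarrow> ('g \<Rightarrow> 'g)
       \<Rightarrow> (('g + unit) letter list \<times> ('g + unit) letter list) set" where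
  "hnn_rels G A \<phi> = table_rels G Inl \<union>
     {([pos (Inr ()), pos (Inl a), neg (Inr ())], [pos (Inl (\<phi> a))]) | a. a \<in> A}"

text \<open>
  The group \<open>K\<close> is an HNN extension of its subgroup \<open>G\<close> with stable letter \<open>t \<in> K\<close>, associated
  subgroups \<open>A, B \<le> G\<close> and isomorphism \<open>\<phi> : A \<rightarrow> B\<close>.
\<close>

definition is_HNN_extension ::
    "('g, 'm) monoid_scheme \<Rightarrow> 'g set \<Rightarrow> 'g \<Rightarrow> 'g set \<Rightarrow> 'g set \<Rightarrow> ('g \<Rightarrow> 'g) \<Rightarrow> bool" where
  "is_HNN_extension K G t A B \<phi> \<longleftrightarrow>
     group K \<and> subgroup G K \<and> t \<in> carrier K \<and>
     subgroup A (K\<lparr>carrier := G\<rparr>) \<and> subgroup B (K\<lparr>carrier := G\<rparr>) \<and>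
     \<phi> \<in> iso (K\<lparr>carrier := A\<rparr>) (K\<lparr>carrier := B\<rparr>) \<and>
     has_presentation K (hnn_gens (K\<lparr>carrier := G\<rparr>)) (case_sum (\<lambda>g. g) (\<lambda>_. t))
       (hnn_rels (K\<lparr>carrier := G\<rparr>) A \<phi>)"

definition is_semidirect_product :: "('g, 'm) monoid_scheme \<Rightarrow> 'g set \<Rightarrow> 'g set \<Rightarrow> bool" where
  "is_semidirect_product G N U \<longleftrightarrow>
     N \<lhd> G \<and> subgroup U G \<and> N \<inter> U = {\<one>\<^bsub>G\<^esub>} \<and> N <#>\<^bsub>G\<^esub> U = carrier G"


section \<open>The singular braid group on three strands\<close>

datatype sb3_gen = Sigma1 | Sigma2 | Tau1 | Tau2

definition sb3_rels :: "(sb3_gen letter list \<times> sb3_gen letter list) set" where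
  "sb3_rels =
    {([pos Sigma1, pos Sigma2, pos Sigma1], [pos Sigma2, pos Sigma1, pos Sigma2]),
     ([pos Sigma1, pos Tau1], [pos Tau1, pos Sigma1]),
     ([pos Sigma2, pos Tau2], [pos Tau2, pos Sigma2]),
     ([pos Sigma1, pos Sigma2, pos Tau1], [pos Tau2, pos Sigma1, pos Sigma2]),
     ([pos Sigma2, pos Sigma1, pos Tau2], [pos Tau1, pos Sigma2, pos Sigma1])}"

definition SB3 :: "sb3_gen letter list set monoid" where
  "SB3 = presented_group UNIV sb3_rels"

definition \<sigma>1 where "\<sigma>1 = pres_gen UNIV sb3_rels Sigma1"
definition \<sigma>2 where "\<sigma>2 = pres_gen UNIV sb3_rels Sigma2"
definition \<tau>1 where "\<tau>1 = pres_gen UNIV sb3_rels Tau1"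
definition \<tau>2 where "\<tau>2 = pres_gen UNIV sb3_rels Tau2"

definition a12 where "a12 = \<sigma>1 [^]\<^bsub>SB3\<^esub> (2::nat)"
definition a23 where "a23 = \<sigma>2 [^]\<^bsub>SB3\<^esub> (2::nat)"
definition a13 where "a13 = \<sigma>2 \<otimes>\<^bsub>SB3\<^esub> \<sigma>1 [^]\<^bsub>SB3\<^esub> (2::nat) \<otimes>\<^bsub>SB3\<^esub> inv\<^bsub>SB3\<^esub> \<sigma>2"
definition c12 where "c12 = \<tau>1"
definition c23 where "c23 = \<tau>2"
definition c13 where "c13 = \<sigma>2 \<otimes>\<^bsub>SB3\<^esub> \<tau>1 \<otimes>\<^bsub>SB3\<^esub> inv\<^bsub>SB3\<^esub> \<sigma>2"

definition ST3 :: "(sb3_gen letter list set \<Rightarrow> nat \<Rightarrow> nat) \<Rightarrow> sb3_gen letter list set monoid" where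
  "ST3 \<pi> = SB3\<lparr>carrier := kernel SB3 (sym_group 3) \<pi>\<rparr>"

text \<open>Abstract generators for the presentation of \<open>H\<close>, and the elements of \<open>SB\<^sub>3\<close> they name.\<close>

datatype h_gen = A13 | A23 | C12 | C13 | C23

fun h_elem :: "h_gen \<Rightarrow> sb3_gen letter list set" where
  "h_elem A13 = a13"
| "h_elem A23 = a23"
| "h_elem C12 = c12"
| "h_elem C13 = c13"
| "h_elem C23 = c23"

definition base_gens :: "h_gen set" where
  "base_gens = {A13, A23, C13, C23}"

definition base_rels :: "(h_gen letter list \<times> h_gen letter list) set" where
  "base_rels =
    {([pos A13, pos C13], [pos C13, pos A13]),
     ([pos A23, pos C23], [pos C23, pos A23])}"

definition h_gens :: "h_gen set" where
  "h_gens = {A13, A23, C12, C13, C23}"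

definition h_rels :: "(h_gen letter list \<times> h_gen letter list) set" where
  "h_rels =
    {([pos A13, pos C13], [pos C13, pos A13]),
     ([pos A23, pos C23], [pos C23, pos A23]),
     ([pos C12, pos A13, pos A23, neg C12], [pos A13, pos A23])}"


section \<open>Presented groups are groups, and their universal property\<close>

lemma words_append [simp]: "u @ v \<in> words S \<longleftrightarrow> u \<in> words S \<and> v \<in> words S"
  by (auto simp: words_def)

lemma words_Nil [simp]: "[] \<in> words S"
  by (simp add: words_def)

lemma words_Cons [simp]: "(x, b) # w \<in> words S \<longleftrightarrow> x \<in> S \<and> w \<in> words S"
  by (auto simp: words_def)

lemma pres_eq_words: "pres_eq S R u v \<Longrightarrow> u \<in> words S \<and> v \<in> words S"
  by (induction rule: pres_eq.induct) auto

lemma pres_class_eq_iff: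
  assumes "u \<in> words S"
  shows "pres_class S R u = pres_class S R v \<longleftrightarrow> pres_eq S R u v"
  unfolding pres_class_def
  using assms pres_eq.refl pres_eq.sym pres_eq.trans by blast

lemma pres_mult:
  assumes "u \<in> words S" "v \<in> words S"
  shows "pres_class S R u \<otimes>\<^bsub>presented_group S R\<^esub> pres_class S R v = pres_class S R (u @ v)"
  unfolding presented_group_def pres_class_def
  using assms by (auto intro: pres_eq.append pres_eq.refl pres_eq.trans)

definition inv_word :: "'x letter list \<Rightarrow> 'x letter list" where
  "inv_word w = rev (map (\<lambda>(x, b). (x, \<not> b)) w)"

lemma inv_word_words [simp]: "w \<in> words S \<Longrightarrow> inv_word w \<in> words S"
  by (auto simp: inv_word_def words_def)

lemma inv_word_cancel: "w \<in> words S \<Longrightarrow> pres_eq S R (inv_word w @ w) []"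
proof (induction w)
  case Nil
  then show ?case by (simp add: inv_word_def pres_eq.refl)
next
  case (Cons l w)
  obtain x b where l: "l = (x, b)" by force
  have x: "x \<in> S" and w: "w \<in> words S" using Cons.prems l by auto
  have "pres_eq S R ([(x, \<not> b), (x, \<not> \<not> b)] @ w) ([] @ w)"
    by (intro pres_eq.append pres_eq.cancel pres_eq.refl x w)
  then have "pres_eq S R ([(x, \<not> b), (x, b)] @ w) w" by simp
  then have "pres_eq S R (inv_word w @ ([(x, \<not> b), (x, b)] @ w)) (inv_word w @ w)"
    by (rule pres_eq.append[OF pres_eq.refl[OF inv_word_words[OF w]]])
  then show ?case
    using Cons.IH[OF w] by (auto simp: inv_word_def l intro: pres_eq.trans)
qed

lemma group_presented_group: "group (presented_group S R)"
proof (rule groupI)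
  let ?P = "presented_group S R"
  have car: "carrier ?P = pres_class S R ` words S" and one: "\<one>\<^bsub>?P\<^esub> = pres_class S R []"
    by (simp_all add: presented_group_def)
  show "\<And>x y. x \<in> carrier ?P \<Longrightarrow> y \<in> carrier ?P \<Longrightarrow> x \<otimes>\<^bsub>?P\<^esub> y \<in> carrier ?P"
    by (auto simp: car pres_mult)
  show "\<one>\<^bsub>?P\<^esub> \<in> carrier ?P" by (simp add: car one)
  show "\<And>x y z. x \<in> carrier ?P \<Longrightarrow> y \<in> carrier ?P \<Longrightarrow> z \<in> carrier ?P \<Longrightarrow>
      x \<otimes>\<^bsub>?P\<^esub> y \<otimes>\<^bsub>?P\<^esub> z = x \<otimes>\<^bsub>?P\<^esub> (y \<otimes>\<^bsub>?P\<^esub> z)"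
    by (auto simp: car pres_mult)
  show "\<And>x. x \<in> carrier ?P \<Longrightarrow> \<one>\<^bsub>?P\<^esub> \<otimes>\<^bsub>?P\<^esub> x = x"
    by (auto simp: car one pres_mult)
  show "\<exists>y\<in>carrier ?P. y \<otimes>\<^bsub>?P\<^esub> x = \<one>\<^bsub>?P\<^esub>" if xP: "x \<in> carrier ?P" for x
  proof -
    obtain w where w: "w \<in> words S" "x = pres_class S R w"
      using xP unfolding car by blast
    have "pres_class S R (inv_word w) \<otimes>\<^bsub>?P\<^esub> x = \<one>\<^bsub>?P\<^esub>"
      using w by (simp add: pres_mult one pres_class_eq_iff inv_word_cancel)
    then show ?thesis using w car by auto
  qed
qed

fun letter_val :: "('g, 'm) monoid_scheme \<Rightarrow> ('x \<Rightarrow> 'g) \<Rightarrow> 'x letter \<Rightarrow> 'g" where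
  "letter_val G f (x, b) = (if b then f x else inv\<^bsub>G\<^esub> f x)"

fun word_val :: "('g, 'm) monoid_scheme \<Rightarrow> ('x \<Rightarrow> 'g) \<Rightarrow> 'x letter list \<Rightarrow> 'g" where
  "word_val G f [] = \<one>\<^bsub>G\<^esub>"
| "word_val G f (l # w) = letter_val G f l \<otimes>\<^bsub>G\<^esub> word_val G f w"

context group
begin

lemma word_val_closed:
  assumes "f ` S \<subseteq> carrier G" "w \<in> words S"
  shows "word_val G f w \<in> carrier G"
  using assms(2)
proof (induction w)
  case (Cons l w)
  then show ?case using assms(1) by (cases l) auto
qed simp

lemma word_val_append:
  assumes "f ` S \<subseteq> carrier G" "u \<in> words S" "v \<in> words S"
  shows "word_val G f (u @ v) = word_val G f u \<otimes> word_val G f v"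
  using assms(2)
proof (induction u)
  case Nil
  then show ?case using word_val_closed[OF assms(1,3)] by simp
next
  case (Cons l u)
  obtain x b where l: "l = (x, b)" by force
  have "letter_val G f l \<in> carrier G" using Cons.prems l assms(1) by auto
  then show ?case
    using Cons l word_val_closed[OF assms(1,3)] word_val_closed[OF assms(1), of u]
    by (simp add: m_assoc)
qed

lemma word_val_pres_eq:
  assumes f: "f ` S \<subseteq> carrier G"
    and R: "\<And>u v. (u, v) \<in> R \<Longrightarrow> word_val G f u = word_val G f v"
    and eq: "pres_eq S R u v"
  shows "word_val G f u = word_val G f v"
  using eq
proof (induction rule: pres_eq.induct)
  case (append u u' v v')
  then show ?case using pres_eq_words by (metis word_val_append[OF f])
next
  case (cancel x b)
  then have "f x \<in> carrier G" using f by auto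
  then show ?case by auto
qed (auto simp: R)

theorem presented_group_universal:
  assumes f: "f ` S \<subseteq> carrier G"
    and R: "\<And>u v. (u, v) \<in> R \<Longrightarrow> word_val G f u = word_val G f v"
  shows "\<exists>h \<in> hom (presented_group S R) G. \<forall>x\<in>S. h (pres_gen S R x) = f x"
proof -
  define h where "h A = word_val G f (SOME w. w \<in> A)" for A
  have h: "h (pres_class S R w) = word_val G f w" if "w \<in> words S" for w
  proof -
    have "w \<in> pres_class S R w" using that by (simp add: pres_class_def pres_eq.refl)
    then have "(SOME v. v \<in> pres_class S R w) \<in> pres_class S R w" by (rule someI)
    then show ?thesis
      unfolding h_def by (metis mem_Collect_eq pres_class_def word_val_pres_eq[OF f R])
  qed
  have "h \<in> hom (presented_group S R) G"
  proof (rule homI)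
    show "\<And>A. A \<in> carrier (presented_group S R) \<Longrightarrow> h A \<in> carrier G"
      by (auto simp: presented_group_def h word_val_closed[OF f])
    fix A B assume "A \<in> carrier (presented_group S R)" "B \<in> carrier (presented_group S R)"
    then obtain u v where "u \<in> words S" "v \<in> words S" "A = pres_class S R u" "B = pres_class S R v"
      by (auto simp: presented_group_def)
    then show "h (A \<otimes>\<^bsub>presented_group S R\<^esub> B) = h A \<otimes> h B"
      by (simp add: pres_mult h word_val_append[OF f])
  qed
  moreover have "h (pres_gen S R x) = f x" if "x \<in> S" for x
    using that f by (auto simp: pres_gen_def h)
  ultimately show ?thesis by blast
qed

end

text \<open>The homomorphism \<open>SB\<^sub>3 \<rightarrow> S\<^sub>3\<close> exists; its values on the generators determine it.\<close>

lemma sb3_to_sym3_exists: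
  "\<exists>\<pi> \<in> hom SB3 (sym_group 3). \<pi> \<sigma>1 = transpose 1 2 \<and> \<pi> \<sigma>2 = transpose 2 3 \<and> \<pi> \<tau>1 = id \<and> \<pi> \<tau>2 = id"
proof -
  interpret S: group "sym_group 3" by (rule sym_group_is_group)
  define f :: "sb3_gen \<Rightarrow> nat \<Rightarrow> nat" where
    "f x = (case x of Sigma1 \<Rightarrow> transpose 1 2 | Sigma2 \<Rightarrow> transpose 2 3 | _ \<Rightarrow> id)" for x
  have "f x permutes {1..3}" for x
    by (cases x) (auto simp: f_def permutes_id intro!: permutes_swap_id)
  then have f: "f ` UNIV \<subseteq> carrier (sym_group 3)" by (auto simp: sym_group_def)
  have braid: "transpose 1 2 \<circ> (transpose 2 3 \<circ> transpose 1 2)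
      = transpose (2::nat) 3 \<circ> (transpose 1 2 \<circ> transpose 2 3)"
    by (auto simp: fun_eq_iff transpose_def)
  have "word_val (sym_group 3) f u = word_val (sym_group 3) f v" if "(u, v) \<in> sb3_rels" for u v :: "sb3_gen letter list"
    using that braid by (auto simp: sb3_rels_def f_def sym_group_def)
  then obtain h where "h \<in> hom SB3 (sym_group 3)" "\<And>x. h (pres_gen UNIV sb3_rels x) = f x"
    using S.presented_group_universal[OF f, of sb3_rels] unfolding SB3_def by blast
  then show ?thesis
    unfolding \<sigma>1_def \<sigma>2_def \<tau>1_def \<tau>2_def by (intro bexI[of _ h]) (simp_all add: f_def)
qed

end

(*
The abstract group H given by the presentation has an automorphism "twist" that imitates
conjugation by sigma1, and twist^2 is conjugation by (a13 a23)^(-1).  The subgroup generated by H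
and sigma1 has index 3 in SB3, with coset representatives 1, sigma2, sigma1 sigma2.  Writing down the
coset action that this predicts on {three cosets} x H x Z, and checking the five defining relations,
one gets an action of SB3 on normal forms; evaluating normal forms in SB3 is equivariant.  Hence every
element of SB3 has a normal form, H embeds in SB3, and sigma1 has infinite order modulo H.

The base group is a retract of H, so no normal form theorem for HNN extensions is needed.
*)
theory Submission
  imports Defs
begin

section \<open>Presented groups\<close>

text \<open>Why three cosets: \<open>H\<close> and \<open>\<sigma>1\<close> together generate the
  preimage of the stabilizer of the symbol 3, and the three representatives carry 3 to 3, 2 and 1.
  Adjoining \<open>\<sigma>1\<close> rather than \<open>a12\<close> keeps the count at three instead
  of six; the price is that conjugation by \<open>a12\<close> on \<open>H\<close> needs a square
  root, which is \<open>twist\<close>. The formula for its square reflects that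
  \<open>a12 a13 a23 = (\<sigma>1 \<sigma>2 \<sigma>1)^2\<close> is central in \<open>SB3\<close>,
  because conjugation by \<open>\<sigma>1 \<sigma>2 \<sigma>1\<close> interchanges the indices 1 and
  2 of \<open>\<sigma>\<close> and \<open>\<tau>\<close>. Hence \<open>a12\<close> acts on
  \<open>H\<close> like the inverse of \<open>a13 a23\<close>. The same fact is the origin of the
  relation for \<open>c12\<close>: \<open>\<tau>1\<close> commutes with \<open>\<sigma>1\<close>,
  hence with \<open>a12\<close>, hence with \<open>a13 a23\<close>.\<close>

lemma pres_gen_closed [simp, intro]:
  "x \<in> S \<Longrightarrow> pres_gen S R x \<in> carrier (presented_group S R)"
  by (auto simp: pres_gen_def presented_group_def)

lemma pres_gen_inv:
  assumes "x \<in> S"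
  shows "inv\<^bsub>presented_group S R\<^esub> (pres_gen S R x) = pres_class S R [neg x]"
proof (rule group.inv_equality[OF group_presented_group])
  have "pres_eq S R [neg x, pos x] []" using pres_eq.cancel[OF assms, of R False] by simp
  then have "pres_class S R [neg x, pos x] = pres_class S R []"
    using assms by (simp add: pres_class_eq_iff)
  moreover have "pres_class S R [neg x] \<otimes>\<^bsub>presented_group S R\<^esub> pres_gen S R x
      = pres_class S R [neg x, pos x]"
    using assms by (simp add: pres_gen_def pres_mult)
  ultimately show "pres_class S R [neg x] \<otimes>\<^bsub>presented_group S R\<^esub> pres_gen S R x
      = \<one>\<^bsub>presented_group S R\<^esub>"
    by (simp add: presented_group_def)
qed (use assms in \<open>auto simp: presented_group_def pres_gen_def\<close>)

lemma pres_class_eq_word_val: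
  assumes "w \<in> words S"
  shows "word_val (presented_group S R) (pres_gen S R) w = pres_class S R w"
  using assms
proof (induction w)
  case (Cons l w)
  obtain x b where l: "l = (x, b)" by force
  have "letter_val (presented_group S R) (pres_gen S R) l = pres_class S R [l]"
    using Cons.prems by (cases b) (simp add: l pres_gen_def, simp add: l pres_gen_inv)
  then show ?case using Cons by (simp add: l pres_mult)
qed (simp add: presented_group_def)

lemma pres_gen_relation:
  assumes "(u, v) \<in> R" "u \<in> words S" "v \<in> words S"
  shows "word_val (presented_group S R) (pres_gen S R) u
    = word_val (presented_group S R) (pres_gen S R) v"
  using assms by (simp add: pres_class_eq_word_val pres_class_eq_iff pres_eq.rel)

lemma (in group) word_val_in_generate:
  assumes "w \<in> words S"
  shows "word_val G f w \<in> generate G (f ` S)"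
  using assms
proof (induction w)
  case (Cons l w)
  then show ?case by (cases l) (auto intro!: generate.eng intro: generate.incl generate.inv)
qed (simp add: generate.one)

lemma carrier_presented_group:
  "carrier (presented_group S R) = generate (presented_group S R) (pres_gen S R ` S)"
proof
  interpret group "presented_group S R" by (rule group_presented_group)
  show "carrier (presented_group S R) \<subseteq> generate (presented_group S R) (pres_gen S R ` S)"
  proof
    fix a assume "a \<in> carrier (presented_group S R)"
    then obtain w where "w \<in> words S" "a = pres_class S R w" by (auto simp: presented_group_def)
    then show "a \<in> generate (presented_group S R) (pres_gen S R ` S)"
      using word_val_in_generate[of w S "pres_gen S R"] by (simp add: pres_class_eq_word_val)
  qed
  show "generate (presented_group S R) (pres_gen S R ` S) \<subseteq> carrier (presented_group S R)"
    by (rule generate_incl) auto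
qed

lemma hom_eq_on_generate:
  assumes "group G" "group K" "f \<in> hom G K" "g \<in> hom G K" "S \<subseteq> carrier G"
    and "\<And>x. x \<in> S \<Longrightarrow> f x = g x" and "a \<in> generate G S"
  shows "f a = g a"
proof -
  interpret f: group_hom G K f using assms by (simp add: group_hom_def group_hom_axioms_def)
  interpret g: group_hom G K g using assms by (simp add: group_hom_def group_hom_axioms_def)
  show ?thesis
    using assms(7)
  proof (induction rule: generate.induct)
    case (inv h)
    then show ?case using assms(5,6) by (metis f.hom_inv g.hom_inv subsetD)
  next
    case (eng a b)
    then show ?case using group.generate_in_carrier[OF assms(1,5)] by simp
  qed (use assms(6) in auto)
qed

lemma hom_eq_on_presented_group:
  assumes "group K" "f \<in> hom (presented_group S R) K" "g \<in> hom (presented_group S R) K"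
    and "\<And>x. x \<in> S \<Longrightarrow> f (pres_gen S R x) = g (pres_gen S R x)"
    and "a \<in> carrier (presented_group S R)"
  shows "f a = g a"
  using hom_eq_on_generate[OF group_presented_group assms(1-3), of "pres_gen S R ` S"] assms(4,5)
  by (auto simp: carrier_presented_group[symmetric])

text \<open>Surjectivity is automatic, since a homomorphism maps a generated subgroup onto the
  subgroup generated by the images. Every presentation below is thereby reduced to an injectivity
  question.\<close>

lemma has_presentation_generate:
  assumes G: "group G" and h: "h \<in> hom (presented_group S R) G"
    and gen: "\<And>x. x \<in> S \<Longrightarrow> h (pres_gen S R x) = f x"
    and inj: "inj_on h (carrier (presented_group S R))"
  shows "has_presentation (G\<lparr>carrier := generate G (f ` S)\<rparr>) S f R"
proof -
  interpret h: group_hom "presented_group S R" G h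
    using G h by (simp add: group_hom_def group_hom_axioms_def group_presented_group)
  have "h ` carrier (presented_group S R) = generate G (h ` pres_gen S R ` S)"
    using h.generate_img[of "pres_gen S R ` S"]
    by (auto simp: carrier_presented_group[symmetric])
  also have "h ` pres_gen S R ` S = f ` S" using gen by (simp add: image_image)
  finally have "h \<in> iso (presented_group S R) (G\<lparr>carrier := generate G (f ` S)\<rparr>)"
    using inj h by (auto simp: iso_def hom_def bij_betw_def)
  then show ?thesis unfolding has_presentation_def using gen by blast
qed

lemma presented_group_left_inverse:
  assumes "h \<in> hom (presented_group S R) G" "g \<in> hom G (presented_group S R)"
    and "\<And>x. x \<in> S \<Longrightarrow> g (h (pres_gen S R x)) = pres_gen S R x"
    and "a \<in> carrier (presented_group S R)"
  shows "g (h a) = a"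
  using hom_eq_on_presented_group[OF group_presented_group hom_compose[OF assms(1,2)]
      iso_imp_homomorphism[OF iso_set_refl]] assms(3,4)
  by (simp add: id_def)

text \<open>Gives the homomorphism of the universal property a name; on the carrier the choice is
  unique by \<open>hom_eq_on_presented_group\<close>.\<close>

definition pres_hom ::
    "'x set \<Rightarrow> ('x letter list \<times> 'x letter list) set \<Rightarrow> ('g, 'm) monoid_scheme \<Rightarrow> ('x \<Rightarrow> 'g)
      \<Rightarrow> 'x letter list set \<Rightarrow> 'g" where
  "pres_hom S R G f =
    (SOME h. h \<in> hom (presented_group S R) G \<and> (\<forall>x\<in>S. h (pres_gen S R x) = f x))"

lemma (in group) pres_hom:
  assumes "f ` S \<subseteq> carrier G" "\<And>u v. (u, v) \<in> R \<Longrightarrow> word_val G f u = word_val G f v"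
  shows pres_hom_hom: "pres_hom S R G f \<in> hom (presented_group S R) G"
    and pres_hom_gen: "x \<in> S \<Longrightarrow> pres_hom S R G f (pres_gen S R x) = f x"
  using someI_ex[OF presented_group_universal[OF assms, unfolded Bex_def]]
  unfolding pres_hom_def by auto

lemma (in group) inv_mult_cancel [simp]:
  "x \<in> carrier G \<Longrightarrow> y \<in> carrier G \<Longrightarrow> inv x \<otimes> (x \<otimes> y) = y"
  "x \<in> carrier G \<Longrightarrow> y \<in> carrier G \<Longrightarrow> x \<otimes> (inv x \<otimes> y) = y"
  by (simp_all add: m_assoc[symmetric])

lemma table_rels_iff:
  "(u, v) \<in> table_rels G \<iota> \<longleftrightarrow> (\<exists>g\<in>carrier G. \<exists>h\<in>carrier G.
    u = [pos (\<iota> g), pos (\<iota> h)] \<and> v = [pos (\<iota> (g \<otimes>\<^bsub>G\<^esub> h))])"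
  by (auto simp: table_rels_def)

lemma hom_of_table_rels:
  assumes "table_rels G \<iota> \<subseteq> R" "\<iota> ` carrier G \<subseteq> S"
    "group G"
  shows "(\<lambda>g. pres_gen S R (\<iota> g)) \<in> hom G (presented_group S R)"
proof (rule homI)
  interpret group "presented_group S R" by (rule group_presented_group)
  interpret G: group G by fact
  fix g h assume gh: "g \<in> carrier G" "h \<in> carrier G"
  then have "([pos (\<iota> g), pos (\<iota> h)], [pos (\<iota> (g \<otimes>\<^bsub>G\<^esub> h))]) \<in> R"
    using assms(1) by (auto simp: table_rels_def)
  from pres_gen_relation[OF this, of S]
  show "pres_gen S R (\<iota> (g \<otimes>\<^bsub>G\<^esub> h))
      = pres_gen S R (\<iota> g) \<otimes>\<^bsub>presented_group S R\<^esub> pres_gen S R (\<iota> h)"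
    using gh assms(2) by (simp add: image_subset_iff)
qed (use assms(2) in auto)

section \<open>The free product of two free abelian groups of rank two\<close>

definition "BP = presented_group base_gens base_rels"
definition "bg = pres_gen base_gens base_rels"

interpretation BP: group BP
  unfolding BP_def by (rule group_presented_group)

lemma bg_closed [simp]:
  "bg A13 \<in> carrier BP" "bg A23 \<in> carrier BP" "bg C13 \<in> carrier BP" "bg C23 \<in> carrier BP"
  by (auto simp: bg_def BP_def base_gens_def)

lemma bg_rels:
  "bg A13 \<otimes>\<^bsub>BP\<^esub> bg C13 = bg C13 \<otimes>\<^bsub>BP\<^esub> bg A13"
  "bg A23 \<otimes>\<^bsub>BP\<^esub> bg C23 = bg C23 \<otimes>\<^bsub>BP\<^esub> bg A23"
proof -
  have "word_val BP bg u = word_val BP bg v" if "(u, v) \<in> base_rels" for u v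
    using pres_gen_relation[OF that, of base_gens] that unfolding BP_def bg_def
    by (auto simp: base_rels_def base_gens_def)
  from this[of "[pos A13, pos C13]"] this[of "[pos A23, pos C23]"]
  show "bg A13 \<otimes>\<^bsub>BP\<^esub> bg C13 = bg C13 \<otimes>\<^bsub>BP\<^esub> bg A13"
    "bg A23 \<otimes>\<^bsub>BP\<^esub> bg C23 = bg C23 \<otimes>\<^bsub>BP\<^esub> bg A23"
    by (auto simp: base_rels_def)
qed

lemma (in group) base_pres_hom:
  assumes "f ` base_gens \<subseteq> carrier G"
    and "f A13 \<otimes> f C13 = f C13 \<otimes> f A13" "f A23 \<otimes> f C23 = f C23 \<otimes> f A23"
  shows base_pres_hom_hom: "pres_hom base_gens base_rels G f \<in> hom BP G"
    and base_pres_hom_gen: "x \<in> base_gens \<Longrightarrow> pres_hom base_gens base_rels G f (bg x) = f x"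
proof -
  have "word_val G f u = word_val G f v" if "(u, v) \<in> base_rels" for u v
    using that assms by (auto simp: base_rels_def base_gens_def)
  from pres_hom[OF assms(1) this]
  show "pres_hom base_gens base_rels G f \<in> hom BP G"
    "x \<in> base_gens \<Longrightarrow> pres_hom base_gens base_rels G f (bg x) = f x"
    by (auto simp: BP_def bg_def)
qed

lemma (in group) int_pow_commute:
  assumes "x \<in> carrier G" "y \<in> carrier G" "x \<otimes> y = y \<otimes> x"
  shows "x [^] (n::int) \<otimes> y = y \<otimes> x [^] n"
proof (cases n rule: int_cases2)
  case (nonneg k)
  then show ?thesis using group_commutes_pow[OF assms(3,1,2), of k] by (simp add: int_pow_int)
next
  case (nonpos k)
  have "y = inv (x [^] k) \<otimes> y \<otimes> x [^] k"
    using group_commutes_pow[OF assms(3,1,2), of k] assms by (metis inv_mult_cancel(1) m_assoc inv_closed m_closed nat_pow_closed)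
  then have "inv (x [^] k) \<otimes> y = y \<otimes> inv (x [^] k)"
    using assms by (metis inv_closed inv_solve_right' m_closed nat_pow_closed)
  then show ?thesis using nonpos assms by (simp add: int_pow_neg_int)
qed

lemma (in group) hom_from_Z2:
  assumes "x \<in> carrier G" "y \<in> carrier G" "x \<otimes> y = y \<otimes> x"
  shows "(\<lambda>(m, n). x [^] m \<otimes> y [^] n) \<in> hom (integer_group \<times>\<times> integer_group) G"
proof (rule homI; clarsimp simp: assms)
  fix a b c d :: int
  have "x [^] c \<otimes> y = y \<otimes> x [^] c" using assms by (rule int_pow_commute)
  then have *: "y [^] b \<otimes> x [^] c = x [^] c \<otimes> y [^] b"
    using assms by (intro int_pow_commute) auto
  have "x [^] a \<otimes> y [^] b \<otimes> (x [^] c \<otimes> y [^] d) = x [^] a \<otimes> (y [^] b \<otimes> x [^] c) \<otimes> y [^] d"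
    using assms by (simp add: m_assoc)
  also have "\<dots> = x [^] (a + c) \<otimes> y [^] (b + d)"
    unfolding * using assms by (simp add: m_assoc int_pow_mult)
  finally show "x [^] (a + c) \<otimes> y [^] (b + d) = x [^] a \<otimes> y [^] b \<otimes> (x [^] c \<otimes> y [^] d)" ..
qed

text \<open>On either axis the map is a homomorphism from the integers, hence a power map, and every
  pair is the sum of its two axis parts.\<close>

lemma (in group) hom_Z2_eq:
  assumes "f \<in> hom (integer_group \<times>\<times> integer_group) G"
  shows "f (m, n) = f (1, 0) [^] m \<otimes> f (0, 1) [^] n"
proof -
  let ?Z = "integer_group \<times>\<times> integer_group"
  interpret Z: group ?Z by (simp add: DirProd_group)
  interpret f: group_hom ?Z G f
    using assms by (simp add: group_hom_def group_hom_axioms_def is_group Z.is_group)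
  have m: "(\<lambda>m. f (m, 0)) \<in> hom integer_group G" and n: "(\<lambda>n. f (0, n)) \<in> hom integer_group G"
    using f.hom_closed by (auto intro!: homI simp flip: f.hom_mult)
  have "f (m, 0) = f (1, 0) [^] m"
    using hom_int_pow[OF m, of 1 m] by simp
  moreover have "f (0, n) = f (0, 1) [^] n"
    using hom_int_pow[OF n, of 1 n] by simp
  ultimately show ?thesis using f.hom_mult[of "(m, 0)" "(0, n)"] by simp
qed

text \<open>Homomorphisms in both directions come from the two universal properties and are inverse
  to each other on generators. On the side of the free product the generators are all elements of
  both copies of Z^2.\<close>

lemma free_product_Z2_Z2_iso:
  "free_product (integer_group \<times>\<times> integer_group) (integer_group \<times>\<times> integer_group)
    \<cong> presented_group base_gens base_rels"
proof -
  let ?Z = "integer_group \<times>\<times> integer_group"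
  let ?S = "Inl ` carrier ?Z \<union> Inr ` carrier ?Z :: ((int \<times> int) + (int \<times> int)) set"
  let ?R = "table_rels ?Z Inl \<union> table_rels ?Z Inr
    :: (((int \<times> int) + (int \<times> int)) letter list \<times> ((int \<times> int) + (int \<times> int)) letter list) set"
  interpret Z: group ?Z by (simp add: DirProd_group)
  define F where "F = presented_group ?S ?R"
  define g where "g = pres_gen ?S ?R"
  interpret F: group F unfolding F_def by (rule group_presented_group)
  have l: "(\<lambda>z. g (Inl z)) \<in> hom ?Z F"
    unfolding F_def g_def by (rule hom_of_table_rels[OF _ _ Z.is_group]) auto
  have r: "(\<lambda>z. g (Inr z)) \<in> hom ?Z F"
    unfolding F_def g_def by (rule hom_of_table_rels[OF _ _ Z.is_group]) auto
  have g_closed [simp]: "g x \<in> carrier F" for x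
    unfolding F_def g_def by (cases x) auto
  \<comment> \<open>The basis vectors (1, 0) and (0, 1) stand for \<open>a\<close> and
    \<open>c\<close>, the left copy for index 13 and the right one for 23. \<open>C12\<close> lies
    outside \<open>base_gens\<close> and gets a default value.\<close>
  define v where "v = case_h_gen (g (Inl (1, 0))) (g (Inr (1, 0))) \<one>\<^bsub>F\<^esub> (g (Inl (0, 1))) (g (Inr (0, 1)))"
  define \<psi> where "\<psi> = pres_hom base_gens base_rels F v"
  have v: "v A13 \<otimes>\<^bsub>F\<^esub> v C13 = v C13 \<otimes>\<^bsub>F\<^esub> v A13" "v A23 \<otimes>\<^bsub>F\<^esub> v C23 = v C23 \<otimes>\<^bsub>F\<^esub> v A23"
    "v ` base_gens \<subseteq> carrier F"
    using hom_mult[OF l, of "(1, 0)" "(0, 1)"] hom_mult[OF l, of "(0, 1)" "(1, 0)"]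
      hom_mult[OF r, of "(1, 0)" "(0, 1)"] hom_mult[OF r, of "(0, 1)" "(1, 0)"]
    by (simp_all add: v_def base_gens_def)
  have \<psi>: "\<psi> \<in> hom BP F" "\<And>x. x \<in> base_gens \<Longrightarrow> \<psi> (bg x) = v x"
    unfolding \<psi>_def using v by (simp_all only: F.base_pres_hom_hom F.base_pres_hom_gen)
  define e where "e = case_sum (\<lambda>(m, n). bg A13 [^]\<^bsub>BP\<^esub> (m::int) \<otimes>\<^bsub>BP\<^esub> bg C13 [^]\<^bsub>BP\<^esub> (n::int))
    (\<lambda>(m, n). bg A23 [^]\<^bsub>BP\<^esub> (m::int) \<otimes>\<^bsub>BP\<^esub> bg C23 [^]\<^bsub>BP\<^esub> (n::int))"
  have el: "(\<lambda>z. e (Inl z)) \<in> hom ?Z BP" and er: "(\<lambda>z. e (Inr z)) \<in> hom ?Z BP"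
    unfolding e_def sum.case by (intro BP.hom_from_Z2 bg_rels bg_closed)+
  have e_closed: "e x \<in> carrier BP" for x
    using hom_in_carrier[OF el] hom_in_carrier[OF er] by (cases x) auto
  have e_rels: "word_val BP e u = word_val BP e w" if "(u, w) \<in> ?R" for u w
    using that hom_mult[OF el] hom_mult[OF er] e_closed by (auto simp: table_rels_iff)
  define \<phi> where "\<phi> = pres_hom ?S ?R BP e"
  have e_img: "e ` ?S \<subseteq> carrier BP" using e_closed by blast
  have \<phi>: "\<phi> \<in> hom F BP"
    unfolding \<phi>_def F_def by (rule BP.pres_hom_hom[OF e_img e_rels])
  have \<phi>_gen: "\<phi> (g x) = e x" for x
  proof -
    have x: "x \<in> ?S" by (cases x) auto
    show ?thesis unfolding \<phi>_def g_def by (rule BP.pres_hom_gen[OF e_img e_rels x])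
  qed
  \<comment> \<open>\<open>e\<close> spells a vector as a product of powers of basis elements;
    \<open>hom_Z2_eq\<close> recombines these powers into a single letter of the free
    product.\<close>
  have \<psi>_e: "\<psi> (e x) = g x" for x
  proof (cases x)
    case (Inl z)
    obtain m n where z: "z = (m, n)" by force
    have "\<psi> (e x) = \<psi> (bg A13) [^]\<^bsub>F\<^esub> m \<otimes>\<^bsub>F\<^esub> \<psi> (bg C13) [^]\<^bsub>F\<^esub> n"
      using \<psi>(1) by (simp add: e_def Inl z hom_mult[OF \<psi>(1)] hom_int_pow[OF \<psi>(1)] BP.is_group F.is_group)
    also have "\<dots> = g x"
      using F.hom_Z2_eq[OF l, of m n] by (simp add: \<psi>(2) base_gens_def v_def Inl z)
    finally show ?thesis .
  next
    case (Inr z)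
    obtain m n where z: "z = (m, n)" by force
    have "\<psi> (e x) = \<psi> (bg A23) [^]\<^bsub>F\<^esub> m \<otimes>\<^bsub>F\<^esub> \<psi> (bg C23) [^]\<^bsub>F\<^esub> n"
      using \<psi>(1) by (simp add: e_def Inr z hom_mult[OF \<psi>(1)] hom_int_pow[OF \<psi>(1)] BP.is_group F.is_group)
    also have "\<dots> = g x"
      using F.hom_Z2_eq[OF r, of m n] by (simp add: \<psi>(2) base_gens_def v_def Inr z)
    finally show ?thesis .
  qed
  have 1: "\<psi> (\<phi> a) = a" if "a \<in> carrier F" for a
    using presented_group_left_inverse[OF \<phi>[unfolded F_def] \<psi>(1)[unfolded F_def]] that \<phi>_gen \<psi>_e
    by (simp add: F_def g_def)
  have "\<phi> (v x) = bg x" if "x \<in> base_gens" for x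
    using that by (auto simp: v_def base_gens_def \<phi>_gen e_def)
  then have 2: "\<phi> (\<psi> b) = b" if "b \<in> carrier BP" for b
    using presented_group_left_inverse[OF \<psi>(1)[unfolded BP_def] \<phi>[unfolded BP_def]]
      that \<psi>(2) by (simp add: BP_def bg_def)
  have "bij_betw \<phi> (carrier F) (carrier BP)"
    using 1 2 \<phi> \<psi>(1) by (intro bij_betw_byWitness[of _ \<psi>]) (auto simp: hom_def)
  then show ?thesis
    using \<phi> unfolding free_product_def BP_def[symmetric] F_def[symmetric] is_iso_def iso_def by blast
qed

section \<open>The abstract group H and its twist\<close>

definition "HP = presented_group h_gens h_rels"
definition "hg = pres_gen h_gens h_rels"

interpretation HP: group HP
  unfolding HP_def by (rule group_presented_group)

lemma h_gens_UNIV: "h_gens = UNIV"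
  by (auto simp: h_gens_def intro: h_gen.exhaust)

lemma hg_closed [simp]: "hg x \<in> carrier HP"
  by (auto simp: hg_def HP_def h_gens_UNIV)

lemma hg_rels:
  "hg A13 \<otimes>\<^bsub>HP\<^esub> hg C13 = hg C13 \<otimes>\<^bsub>HP\<^esub> hg A13"
  "hg A23 \<otimes>\<^bsub>HP\<^esub> hg C23 = hg C23 \<otimes>\<^bsub>HP\<^esub> hg A23"
  "hg C12 \<otimes>\<^bsub>HP\<^esub> (hg A13 \<otimes>\<^bsub>HP\<^esub> hg A23) = hg A13 \<otimes>\<^bsub>HP\<^esub> (hg A23 \<otimes>\<^bsub>HP\<^esub> hg C12)"
proof -
  have *: "word_val HP hg u = word_val HP hg v" if "(u, v) \<in> h_rels" for u v
    using pres_gen_relation[OF that, of h_gens] that unfolding HP_def hg_def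
    by (auto simp: h_rels_def h_gens_UNIV)
  from *[of "[pos A13, pos C13]"] *[of "[pos A23, pos C23]"]
  show "hg A13 \<otimes>\<^bsub>HP\<^esub> hg C13 = hg C13 \<otimes>\<^bsub>HP\<^esub> hg A13"
    "hg A23 \<otimes>\<^bsub>HP\<^esub> hg C23 = hg C23 \<otimes>\<^bsub>HP\<^esub> hg A23"
    by (auto simp: h_rels_def)
  have "hg C12 \<otimes>\<^bsub>HP\<^esub> hg A13 \<otimes>\<^bsub>HP\<^esub> hg A23 \<otimes>\<^bsub>HP\<^esub> inv\<^bsub>HP\<^esub> hg C12 = hg A13 \<otimes>\<^bsub>HP\<^esub> hg A23"
    using *[of "[pos C12, pos A13, pos A23, neg C12]"] by (simp add: h_rels_def HP.m_assoc)
  then show "hg C12 \<otimes>\<^bsub>HP\<^esub> (hg A13 \<otimes>\<^bsub>HP\<^esub> hg A23) = hg A13 \<otimes>\<^bsub>HP\<^esub> (hg A23 \<otimes>\<^bsub>HP\<^esub> hg C12)"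
    by (metis HP.inv_solve_right HP.m_assoc HP.m_closed HP.inv_closed HP.inv_inv HP.inv_mult_cancel HP.r_one HP.l_inv hg_closed)
qed

lemma (in group) h_pres_hom:
  assumes "\<And>x. f x \<in> carrier G"
    and "f A13 \<otimes> f C13 = f C13 \<otimes> f A13" "f A23 \<otimes> f C23 = f C23 \<otimes> f A23"
    and "f C12 \<otimes> (f A13 \<otimes> f A23) = f A13 \<otimes> (f A23 \<otimes> f C12)"
  shows h_pres_hom_hom: "pres_hom h_gens h_rels G f \<in> hom HP G"
    and h_pres_hom_gen: "pres_hom h_gens h_rels G f (hg x) = f x"
proof -
  have "f C12 \<otimes> (f A13 \<otimes> (f A23 \<otimes> inv f C12)) = f C12 \<otimes> (f A13 \<otimes> f A23) \<otimes> inv f C12"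
    using assms(1) by (simp add: m_assoc)
  also have "\<dots> = f A13 \<otimes> f A23"
    unfolding assms(4) using assms(1) by (simp add: m_assoc)
  finally have "word_val G f u = word_val G f v" if "(u, v) \<in> h_rels" for u v
    using that assms(1-3) by (auto simp: h_rels_def)
  from pres_hom[of f h_gens, OF _ this]
  show "pres_hom h_gens h_rels G f \<in> hom HP G"
    "pres_hom h_gens h_rels G f (hg x) = f x"
    using assms(1) by (auto simp: HP_def hg_def h_gens_UNIV)
qed

text \<open>The Hurwitz move \<open>(x, y) \<mapsto> (y, y^-1 x y)\<close> on the pair
  \<open>(A13, A23)\<close>, with \<open>(C13, C23)\<close> carried along. It preserves the product
  \<open>A13 A23\<close>, so the relation for \<open>C12\<close> survives with \<open>C12\<close>
  fixed, and the two commutation relations are exchanged up to conjugation.\<close>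

fun twist_gens :: "h_gen \<Rightarrow> h_gen letter list set" where
  "twist_gens A13 = hg A23"
| "twist_gens A23 = inv\<^bsub>HP\<^esub> (hg A23) \<otimes>\<^bsub>HP\<^esub> (hg A13 \<otimes>\<^bsub>HP\<^esub> hg A23)"
| "twist_gens C12 = hg C12"
| "twist_gens C13 = hg C23"
| "twist_gens C23 = inv\<^bsub>HP\<^esub> (hg A23) \<otimes>\<^bsub>HP\<^esub> (hg C13 \<otimes>\<^bsub>HP\<^esub> hg A23)"

text \<open>The inverse Hurwitz move \<open>(x, y) \<mapsto> (x y x^-1, x)\<close>.\<close>

fun untwist_gens :: "h_gen \<Rightarrow> h_gen letter list set" where
  "untwist_gens A13 = hg A13 \<otimes>\<^bsub>HP\<^esub> (hg A23 \<otimes>\<^bsub>HP\<^esub> inv\<^bsub>HP\<^esub> (hg A13))"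
| "untwist_gens A23 = hg A13"
| "untwist_gens C12 = hg C12"
| "untwist_gens C13 = hg A13 \<otimes>\<^bsub>HP\<^esub> (hg C23 \<otimes>\<^bsub>HP\<^esub> inv\<^bsub>HP\<^esub> (hg A13))"
| "untwist_gens C23 = hg C13"

text \<open>The map \<open>twist\<close> is conjugation by \<open>\<sigma>1\<close>, see \<open>emb_twist\<close> below.\<close>

definition "twist = pres_hom h_gens h_rels HP twist_gens"

definition "untwist = pres_hom h_gens h_rels HP untwist_gens"

lemma (in group) commute_left:
  "x \<otimes> y = y \<otimes> x \<Longrightarrow> x \<in> carrier G \<Longrightarrow> y \<in> carrier G \<Longrightarrow> z \<in> carrier G \<Longrightarrow> x \<otimes> (y \<otimes> z) = y \<otimes> (x \<otimes> z)"
  by (metis m_assoc)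

lemma twist_hom: "twist \<in> hom HP HP"
  and twist_hg: "twist (hg x) = twist_gens x"
proof -
  have closed: "twist_gens x \<in> carrier HP" for x by (cases x) auto
  have rels: "twist_gens A13 \<otimes>\<^bsub>HP\<^esub> twist_gens C13 = twist_gens C13 \<otimes>\<^bsub>HP\<^esub> twist_gens A13"
    "twist_gens A23 \<otimes>\<^bsub>HP\<^esub> twist_gens C23 = twist_gens C23 \<otimes>\<^bsub>HP\<^esub> twist_gens A23"
    "twist_gens C12 \<otimes>\<^bsub>HP\<^esub> (twist_gens A13 \<otimes>\<^bsub>HP\<^esub> twist_gens A23)
      = twist_gens A13 \<otimes>\<^bsub>HP\<^esub> (twist_gens A23 \<otimes>\<^bsub>HP\<^esub> twist_gens C12)"
    by (simp_all add: HP.m_assoc hg_rels HP.commute_left[OF hg_rels(1)])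
  show "twist \<in> hom HP HP" "twist (hg x) = twist_gens x"
    unfolding twist_def by (rule HP.h_pres_hom[of twist_gens, OF closed rels])+
qed

lemma untwist_hom: "untwist \<in> hom HP HP"
  and untwist_hg: "untwist (hg x) = untwist_gens x"
proof -
  have closed: "untwist_gens x \<in> carrier HP" for x by (cases x) auto
  have rels: "untwist_gens A13 \<otimes>\<^bsub>HP\<^esub> untwist_gens C13 = untwist_gens C13 \<otimes>\<^bsub>HP\<^esub> untwist_gens A13"
    "untwist_gens A23 \<otimes>\<^bsub>HP\<^esub> untwist_gens C23 = untwist_gens C23 \<otimes>\<^bsub>HP\<^esub> untwist_gens A23"
    "untwist_gens C12 \<otimes>\<^bsub>HP\<^esub> (untwist_gens A13 \<otimes>\<^bsub>HP\<^esub> untwist_gens A23)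
      = untwist_gens A13 \<otimes>\<^bsub>HP\<^esub> (untwist_gens A23 \<otimes>\<^bsub>HP\<^esub> untwist_gens C12)"
    by (simp_all add: HP.m_assoc hg_rels HP.commute_left[OF hg_rels(2)])
  show "untwist \<in> hom HP HP" "untwist (hg x) = untwist_gens x"
    unfolding untwist_def by (rule HP.h_pres_hom[of untwist_gens, OF closed rels])+
qed

lemmas twist_gen [simp] = twist_hg[of A13, simplified] twist_hg[of A23, simplified]
  twist_hg[of C12, simplified] twist_hg[of C13, simplified] twist_hg[of C23, simplified]

lemmas untwist_gen [simp] = untwist_hg[of A13, simplified] untwist_hg[of A23, simplified]
  untwist_hg[of C12, simplified] untwist_hg[of C13, simplified] untwist_hg[of C23, simplified]

interpretation twist: group_hom HP HP twist
  by unfold_locales (rule twist_hom)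

interpretation untwist: group_hom HP HP untwist
  by unfold_locales (rule untwist_hom)

lemma twist_inverse [simp]:
  assumes "k \<in> carrier HP"
  shows "untwist (twist k) = k" "twist (untwist k) = k"
proof -
  have "untwist (twist (hg x)) = hg x \<and> twist (untwist (hg x)) = hg x" for x
    by (cases x) (simp_all add: HP.m_assoc)
  then show "untwist (twist k) = k" "twist (untwist k) = k"
    using presented_group_left_inverse[of twist h_gens h_rels HP untwist k]
      presented_group_left_inverse[of untwist h_gens h_rels HP twist k] assms
      twist_hom untwist_hom
    by (auto simp: HP_def[symmetric] hg_def[symmetric])
qed

section \<open>The action of the singular braid group on cosets\<close>

interpretation SB: group SB3
  unfolding SB3_def by (rule group_presented_group)

lemma sb3_gen_closed [simp]:
  "\<sigma>1 \<in> carrier SB3" "\<sigma>2 \<in> carrier SB3" "\<tau>1 \<in> carrier SB3" "\<tau>2 \<in> carrier SB3"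
  by (auto simp: \<sigma>1_def \<sigma>2_def \<tau>1_def \<tau>2_def SB3_def)

lemma sb3_relations:
  "\<sigma>1 \<otimes>\<^bsub>SB3\<^esub> (\<sigma>2 \<otimes>\<^bsub>SB3\<^esub> \<sigma>1) = \<sigma>2 \<otimes>\<^bsub>SB3\<^esub> (\<sigma>1 \<otimes>\<^bsub>SB3\<^esub> \<sigma>2)"
  "\<sigma>1 \<otimes>\<^bsub>SB3\<^esub> \<tau>1 = \<tau>1 \<otimes>\<^bsub>SB3\<^esub> \<sigma>1"
  "\<sigma>2 \<otimes>\<^bsub>SB3\<^esub> \<tau>2 = \<tau>2 \<otimes>\<^bsub>SB3\<^esub> \<sigma>2"
  "\<sigma>1 \<otimes>\<^bsub>SB3\<^esub> (\<sigma>2 \<otimes>\<^bsub>SB3\<^esub> \<tau>1) = \<tau>2 \<otimes>\<^bsub>SB3\<^esub> (\<sigma>1 \<otimes>\<^bsub>SB3\<^esub> \<sigma>2)"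
  "\<tau>1 \<otimes>\<^bsub>SB3\<^esub> (\<sigma>2 \<otimes>\<^bsub>SB3\<^esub> \<sigma>1) = \<sigma>2 \<otimes>\<^bsub>SB3\<^esub> (\<sigma>1 \<otimes>\<^bsub>SB3\<^esub> \<tau>2)"
proof -
  define f where "f = pres_gen UNIV sb3_rels"
  have *: "word_val SB3 f u = word_val SB3 f v" if "(u, v) \<in> sb3_rels" for u v
    using pres_gen_relation[OF that, of UNIV] unfolding SB3_def f_def by (simp add: words_def)
  have f: "f Sigma1 = \<sigma>1" "f Sigma2 = \<sigma>2" "f Tau1 = \<tau>1" "f Tau2 = \<tau>2"
    by (simp_all add: f_def \<sigma>1_def \<sigma>2_def \<tau>1_def \<tau>2_def)
  note simps = sb3_rels_def f
  show "\<sigma>1 \<otimes>\<^bsub>SB3\<^esub> (\<sigma>2 \<otimes>\<^bsub>SB3\<^esub> \<sigma>1) = \<sigma>2 \<otimes>\<^bsub>SB3\<^esub> (\<sigma>1 \<otimes>\<^bsub>SB3\<^esub> \<sigma>2)"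
    using *[of "[pos Sigma1, pos Sigma2, pos Sigma1]" "[pos Sigma2, pos Sigma1, pos Sigma2]"]
    by (simp add: simps)
  show "\<sigma>1 \<otimes>\<^bsub>SB3\<^esub> \<tau>1 = \<tau>1 \<otimes>\<^bsub>SB3\<^esub> \<sigma>1"
    using *[of "[pos Sigma1, pos Tau1]" "[pos Tau1, pos Sigma1]"] by (simp add: simps)
  show "\<sigma>2 \<otimes>\<^bsub>SB3\<^esub> \<tau>2 = \<tau>2 \<otimes>\<^bsub>SB3\<^esub> \<sigma>2"
    using *[of "[pos Sigma2, pos Tau2]" "[pos Tau2, pos Sigma2]"] by (simp add: simps)
  show "\<sigma>1 \<otimes>\<^bsub>SB3\<^esub> (\<sigma>2 \<otimes>\<^bsub>SB3\<^esub> \<tau>1) = \<tau>2 \<otimes>\<^bsub>SB3\<^esub> (\<sigma>1 \<otimes>\<^bsub>SB3\<^esub> \<sigma>2)"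
    using *[of "[pos Sigma1, pos Sigma2, pos Tau1]" "[pos Tau2, pos Sigma1, pos Sigma2]"]
    by (simp add: simps)
  show "\<tau>1 \<otimes>\<^bsub>SB3\<^esub> (\<sigma>2 \<otimes>\<^bsub>SB3\<^esub> \<sigma>1) = \<sigma>2 \<otimes>\<^bsub>SB3\<^esub> (\<sigma>1 \<otimes>\<^bsub>SB3\<^esub> \<tau>2)"
    using *[of "[pos Sigma2, pos Sigma1, pos Tau2]" "[pos Tau1, pos Sigma2, pos Sigma1]"]
    by (simp add: simps)
qed

lemma sb3_relations_left:
  assumes "z \<in> carrier SB3"
  shows
  "\<sigma>1 \<otimes>\<^bsub>SB3\<^esub> (\<sigma>2 \<otimes>\<^bsub>SB3\<^esub> (\<sigma>1 \<otimes>\<^bsub>SB3\<^esub> z)) = \<sigma>2 \<otimes>\<^bsub>SB3\<^esub> (\<sigma>1 \<otimes>\<^bsub>SB3\<^esub> (\<sigma>2 \<otimes>\<^bsub>SB3\<^esub> z))"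
  "\<sigma>1 \<otimes>\<^bsub>SB3\<^esub> (\<tau>1 \<otimes>\<^bsub>SB3\<^esub> z) = \<tau>1 \<otimes>\<^bsub>SB3\<^esub> (\<sigma>1 \<otimes>\<^bsub>SB3\<^esub> z)"
  "\<sigma>2 \<otimes>\<^bsub>SB3\<^esub> (\<tau>2 \<otimes>\<^bsub>SB3\<^esub> z) = \<tau>2 \<otimes>\<^bsub>SB3\<^esub> (\<sigma>2 \<otimes>\<^bsub>SB3\<^esub> z)"
  "\<sigma>1 \<otimes>\<^bsub>SB3\<^esub> (\<sigma>2 \<otimes>\<^bsub>SB3\<^esub> (\<tau>1 \<otimes>\<^bsub>SB3\<^esub> z)) = \<tau>2 \<otimes>\<^bsub>SB3\<^esub> (\<sigma>1 \<otimes>\<^bsub>SB3\<^esub> (\<sigma>2 \<otimes>\<^bsub>SB3\<^esub> z))"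
  "\<tau>1 \<otimes>\<^bsub>SB3\<^esub> (\<sigma>2 \<otimes>\<^bsub>SB3\<^esub> (\<sigma>1 \<otimes>\<^bsub>SB3\<^esub> z)) = \<sigma>2 \<otimes>\<^bsub>SB3\<^esub> (\<sigma>1 \<otimes>\<^bsub>SB3\<^esub> (\<tau>2 \<otimes>\<^bsub>SB3\<^esub> z))"
  using assms sb3_relations[THEN arg_cong, of "\<lambda>x. x \<otimes>\<^bsub>SB3\<^esub> z"] by (simp_all add: SB.m_assoc)

lemmas braid_simps = a12_def a13_def a23_def c12_def c13_def c23_def numeral_2_eq_2
  SB.m_assoc SB.inv_mult_group sb3_relations sb3_relations_left

section \<open>Mapping the abstract group into the singular braid group\<close>

lemma h_elem_closed [simp]: "h_elem x \<in> carrier SB3"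
  by (cases x) (auto simp: a12_def a13_def a23_def c12_def c13_def c23_def)

lemmas elem_closed = h_elem_closed[of A13, simplified] h_elem_closed[of A23, simplified]
  h_elem_closed[of C12, simplified] h_elem_closed[of C13, simplified] h_elem_closed[of C23, simplified]

definition "emb = pres_hom h_gens h_rels SB3 h_elem"

text \<open>For the third relation,
  \<open>a13 a23 = \<sigma>2 \<sigma>1 \<sigma>1 \<sigma>2\<close>, and \<open>\<tau>1\<close>
  slides across \<open>\<sigma>2 \<sigma>1\<close> to become \<open>\<tau>2\<close> and across
  \<open>\<sigma>1 \<sigma>2\<close> to become \<open>\<tau>1\<close> again.\<close>

lemma emb_hom: "emb \<in> hom HP SB3"
  and emb_gen: "emb (hg x) = h_elem x"
  unfolding emb_def by (rule SB.h_pres_hom; simp add: braid_simps)+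

interpretation emb: group_hom HP SB3 emb
  by unfold_locales (rule emb_hom)

lemma emb_twist:
  assumes "k \<in> carrier HP"
  shows "emb (twist k) = \<sigma>1 \<otimes>\<^bsub>SB3\<^esub> (emb k \<otimes>\<^bsub>SB3\<^esub> inv\<^bsub>SB3\<^esub> \<sigma>1)"
proof -
  have 1: "(\<lambda>k. emb (twist k)) \<in> hom HP SB3"
    by (rule homI) auto
  have 2: "(\<lambda>k. \<sigma>1 \<otimes>\<^bsub>SB3\<^esub> (emb k \<otimes>\<^bsub>SB3\<^esub> inv\<^bsub>SB3\<^esub> \<sigma>1)) \<in> hom HP SB3"
    by (rule homI) (auto simp: SB.m_assoc)
  \<comment> \<open>Multiplied by \<open>\<sigma>1\<close> on the right, so that no inverse of
    \<open>\<sigma>1\<close> is left and the braid relations decide all five cases.\<close>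
  have "emb (twist (hg x)) \<otimes>\<^bsub>SB3\<^esub> \<sigma>1 = \<sigma>1 \<otimes>\<^bsub>SB3\<^esub> emb (hg x)" for x
    by (cases x) (simp_all add: emb_gen, simp_all add: braid_simps)
  then have "emb (twist (hg x)) = \<sigma>1 \<otimes>\<^bsub>SB3\<^esub> (emb (hg x) \<otimes>\<^bsub>SB3\<^esub> inv\<^bsub>SB3\<^esub> \<sigma>1)" for x
    by (simp add: SB.m_assoc[symmetric] SB.inv_solve_right)
  then show ?thesis
    using hom_eq_on_presented_group[OF SB.is_group 1[unfolded HP_def] 2[unfolded HP_def]] assms
    by (simp add: HP_def hg_def)
qed

lemma emb_twist_left:
  "k \<in> carrier HP \<Longrightarrow> z \<in> carrier SB3 \<Longrightarrow>
    emb (twist k) \<otimes>\<^bsub>SB3\<^esub> (\<sigma>1 \<otimes>\<^bsub>SB3\<^esub> z) = \<sigma>1 \<otimes>\<^bsub>SB3\<^esub> (emb k \<otimes>\<^bsub>SB3\<^esub> z)"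
  by (simp add: emb_twist SB.m_assoc)

section \<open>Normal forms and the permutations given by the generators\<close>

datatype coset = Q0 | Q1 | Q2

type_synonym point = "coset \<times> h_gen letter list set \<times> int"

definition points :: "point set" where
  "points = UNIV \<times> carrier HP \<times> UNIV"

lemma points_iff [simp]: "(q, k, n) \<in> points \<longleftrightarrow> k \<in> carrier HP"
  by (simp add: points_def)

fun coset_rep where
  "coset_rep Q0 = \<one>\<^bsub>SB3\<^esub>"
| "coset_rep Q1 = \<sigma>2"
| "coset_rep Q2 = \<sigma>1 \<otimes>\<^bsub>SB3\<^esub> \<sigma>2"

lemma coset_rep_closed [simp]: "coset_rep q \<in> carrier SB3"
  by (cases q) auto

fun point_val :: "point \<Rightarrow> sb3_gen letter list set" where
  "point_val (q, k, n) = coset_rep q \<otimes>\<^bsub>SB3\<^esub> (emb k \<otimes>\<^bsub>SB3\<^esub> \<sigma>1 [^]\<^bsub>SB3\<^esub> n)"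

text \<open>
  A triple \<open>(q, k, n)\<close> stands for the element \<open>r\<^sub>q k \<sigma>1\<^sup>n\<close> of \<open>SB\<^sub>3\<close>, where the representatives
  \<open>r\<^sub>q\<close> are \<open>1\<close>, \<open>\<sigma>2\<close>, \<open>\<sigma>1 \<sigma>2\<close>; \<open>act x\<close> is what left multiplication by \<open>x\<close> must do to such normal
  forms.  For example \<open>\<sigma>1 (\<sigma>1 \<sigma>2) = \<sigma>2 (\<sigma>2\<inverse> \<sigma>1\<^sup>2 \<sigma>2)\<close> with \<open>\<sigma>2\<inverse> \<sigma>1\<^sup>2 \<sigma>2 = \<sigma>1 a\<^sub>2\<^sub>3 \<sigma>1\<inverse>\<close> gives the
  third equation.
\<close>

fun act :: "sb3_gen \<Rightarrow> point \<Rightarrow> point" where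
  "act Sigma1 (Q0, k, n) = (Q0, twist k, n + 1)"
| "act Sigma1 (Q1, k, n) = (Q2, k, n)"
| "act Sigma1 (Q2, k, n) = (Q1, twist (hg A23) \<otimes>\<^bsub>HP\<^esub> k, n)"
| "act Sigma2 (Q0, k, n) = (Q1, k, n)"
| "act Sigma2 (Q1, k, n) = (Q0, hg A23 \<otimes>\<^bsub>HP\<^esub> k, n)"
| "act Sigma2 (Q2, k, n) = (Q2, twist k, n + 1)"
| "act Tau1 (Q0, k, n) = (Q0, hg C12 \<otimes>\<^bsub>HP\<^esub> k, n)"
| "act Tau1 (q, k, n) = (q, twist (hg C23) \<otimes>\<^bsub>HP\<^esub> k, n)"
| "act Tau2 (Q2, k, n) = (Q2, hg C12 \<otimes>\<^bsub>HP\<^esub> k, n)"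
| "act Tau2 (q, k, n) = (q, hg C23 \<otimes>\<^bsub>HP\<^esub> k, n)"

text \<open>Explicit inverses show that each \<open>act x\<close> is a permutation, as the universal
  property requires values in a group. \<open>untwist\<close> undoes the two rows in which a power
  of \<open>\<sigma>1\<close> is split off to the right.\<close>

fun act_inv :: "sb3_gen \<Rightarrow> point \<Rightarrow> point" where
  "act_inv Sigma1 (Q0, k, n) = (Q0, untwist k, n - 1)"
| "act_inv Sigma1 (Q2, k, n) = (Q1, k, n)"
| "act_inv Sigma1 (Q1, k, n) = (Q2, inv\<^bsub>HP\<^esub> twist (hg A23) \<otimes>\<^bsub>HP\<^esub> k, n)"
| "act_inv Sigma2 (Q1, k, n) = (Q0, k, n)"
| "act_inv Sigma2 (Q0, k, n) = (Q1, inv\<^bsub>HP\<^esub> hg A23 \<otimes>\<^bsub>HP\<^esub> k, n)"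
| "act_inv Sigma2 (Q2, k, n) = (Q2, untwist k, n - 1)"
| "act_inv Tau1 (Q0, k, n) = (Q0, inv\<^bsub>HP\<^esub> hg C12 \<otimes>\<^bsub>HP\<^esub> k, n)"
| "act_inv Tau1 (q, k, n) = (q, inv\<^bsub>HP\<^esub> twist (hg C23) \<otimes>\<^bsub>HP\<^esub> k, n)"
| "act_inv Tau2 (Q2, k, n) = (Q2, inv\<^bsub>HP\<^esub> hg C12 \<otimes>\<^bsub>HP\<^esub> k, n)"
| "act_inv Tau2 (q, k, n) = (q, inv\<^bsub>HP\<^esub> hg C23 \<otimes>\<^bsub>HP\<^esub> k, n)"

lemma act_points: "p \<in> points \<Longrightarrow> act x p \<in> points"
  by (cases "(x, p)" rule: act.cases) (auto simp del: twist_gen)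

lemma act_inv_points: "p \<in> points \<Longrightarrow> act_inv x p \<in> points"
  by (cases "(x, p)" rule: act_inv.cases) (auto simp del: twist_gen)

lemma act_inv_act: "p \<in> points \<Longrightarrow> act_inv x (act x p) = p"
  by (cases "(x, p)" rule: act.cases) (auto simp del: twist_gen)

lemma act_act_inv: "p \<in> points \<Longrightarrow> act x (act_inv x p) = p"
  by (cases "(x, p)" rule: act_inv.cases) (auto simp del: twist_gen)

interpretation perm: group "BijGroup points"
  by (rule group_BijGroup)

lemma BijGroup_mult_apply:
  "f \<in> carrier (BijGroup S) \<Longrightarrow> g \<in> carrier (BijGroup S) \<Longrightarrow> x \<in> S \<Longrightarrow>
    (f \<otimes>\<^bsub>BijGroup S\<^esub> g) x = f (g x)"
  by (simp add: BijGroup_def compose_def)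

lemma BijGroup_apply_closed: "f \<in> carrier (BijGroup S) \<Longrightarrow> x \<in> S \<Longrightarrow> f x \<in> S"
  using Bij_imp_funcset by (fastforce simp: BijGroup_def)

lemma BijGroup_one_apply [simp]: "x \<in> S \<Longrightarrow> \<one>\<^bsub>BijGroup S\<^esub> x = x"
  by (simp add: BijGroup_def)

lemma BijGroup_eqI:
  "f \<in> carrier (BijGroup S) \<Longrightarrow> g \<in> carrier (BijGroup S) \<Longrightarrow> (\<And>x. x \<in> S \<Longrightarrow> f x = g x) \<Longrightarrow> f = g"
  by (auto simp: BijGroup_def Bij_def intro: extensionalityI)

lemma act_BijGroup: "restrict (act x) points \<in> carrier (BijGroup points)"
proof -
  have "bij_betw (act x) points points"
    by (rule bij_betw_byWitness[of _ "act_inv x"])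
      (auto simp: act_inv_act act_act_inv act_points act_inv_points)
  then show ?thesis by (simp add: BijGroup_def Bij_def cong: bij_betw_cong)
qed

text \<open>On each of the three cosets, each of the five relations becomes an identity in
  \<open>HP\<close>. The braid relation on \<open>Q2\<close>, for instance, says that
  \<open>twist\<close> fixes \<open>A23 * twist A23 = A13 A23\<close>.\<close>

lemma act_rels:
  assumes "(u, v) \<in> sb3_rels"
  shows "word_val (BijGroup points) (\<lambda>x. restrict (act x) points) u
    = word_val (BijGroup points) (\<lambda>x. restrict (act x) points) v"
proof (rule BijGroup_eqI)
  let ?w = "word_val (BijGroup points) (\<lambda>x. restrict (act x) points)"
  have closed: "?w w \<in> carrier (BijGroup points)" for w
    using perm.word_val_closed[of "\<lambda>x. restrict (act x) points" UNIV w] act_BijGroup by (auto simp: words_def)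
  show "?w u \<in> carrier (BijGroup points)" "?w v \<in> carrier (BijGroup points)"
    by (rule closed)+
  fix p assume p: "p \<in> points"
  have step: "?w (pos x # w) p = act x (?w w p)" if "p \<in> points" for x w p
    using that closed act_BijGroup by (simp add: BijGroup_mult_apply BijGroup_apply_closed)
  obtain q k n where pq: "p = (q, k, n)" and k: "k \<in> carrier HP"
    using p by (cases p) auto
  note hp = HP.m_assoc HP.inv_mult_group hg_rels
    HP.commute_left[OF hg_rels(1)] HP.commute_left[OF hg_rels(2)]
  \<comment> \<open>Needed for
    \<open>\<sigma>1 \<sigma>2 \<tau>1 = \<tau>2 \<sigma>1 \<sigma>2\<close> on \<open>Q1\<close>
    and \<open>Q2\<close>: there \<open>twist (twist C23)\<close> has to equal \<open>C23\<close>
    conjugated by the inverse of \<open>twist A23\<close>, and the two differ by moving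
    \<open>A23^-1\<close> past \<open>C23\<close>.\<close>
  have C: "inv\<^bsub>HP\<^esub> hg A23 \<otimes>\<^bsub>HP\<^esub> (hg C23 \<otimes>\<^bsub>HP\<^esub> z) = hg C23 \<otimes>\<^bsub>HP\<^esub> (inv\<^bsub>HP\<^esub> hg A23 \<otimes>\<^bsub>HP\<^esub> z)"
    if "z \<in> carrier HP" for z
    using that HP.int_pow_commute[OF _ _ hg_rels(2), of "-1"]
    by (intro HP.commute_left) (simp_all add: HP.int_pow_neg)
  \<comment> \<open>Needed for
    \<open>\<sigma>2 \<sigma>1 \<tau>2 = \<tau>1 \<sigma>2 \<sigma>1\<close> on \<open>Q2\<close>:
    the sides differ by moving \<open>C12\<close> across \<open>A23 * twist A23 = A13 A23\<close>,
    which is the relation of the stable letter.\<close>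
  have D: "hg C12 \<otimes>\<^bsub>HP\<^esub> (hg A13 \<otimes>\<^bsub>HP\<^esub> (hg A23 \<otimes>\<^bsub>HP\<^esub> k)) = hg A13 \<otimes>\<^bsub>HP\<^esub> (hg A23 \<otimes>\<^bsub>HP\<^esub> (hg C12 \<otimes>\<^bsub>HP\<^esub> k))"
    using arg_cong[OF hg_rels(3), of "\<lambda>x. x \<otimes>\<^bsub>HP\<^esub> k"] k by (simp add: HP.m_assoc)
  show "?w u p = ?w v p"
    using assms unfolding sb3_rels_def
    by (elim insertE emptyE; cases q) (simp_all add: step pq k hp C D del: word_val.simps(2))
qed

definition "action = pres_hom UNIV sb3_rels (BijGroup points) (\<lambda>x. restrict (act x) points)"

lemma action_hom: "action \<in> hom SB3 (BijGroup points)"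
  unfolding action_def SB3_def
  by (rule perm.pres_hom_hom[OF _ act_rels]) (use act_BijGroup in auto)

lemma action_pres_gen: "p \<in> points \<Longrightarrow> action (pres_gen UNIV sb3_rels x) p = act x p"
  unfolding action_def
  by (subst perm.pres_hom_gen[OF _ act_rels]) (use act_BijGroup in auto)

lemma action_gen:
  assumes "p \<in> points"
  shows "action \<sigma>1 p = act Sigma1 p" "action \<sigma>2 p = act Sigma2 p"
    "action \<tau>1 p = act Tau1 p" "action \<tau>2 p = act Tau2 p"
  using assms by (simp_all add: \<sigma>1_def \<sigma>2_def \<tau>1_def \<tau>2_def action_pres_gen)

interpretation action: group_hom SB3 "BijGroup points" action
  by unfold_locales (rule action_hom)

declare action.hom_one [simp del] action.hom_mult [simp del] action.hom_inv [simp del]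

lemma action_mult:
  "g \<in> carrier SB3 \<Longrightarrow> h \<in> carrier SB3 \<Longrightarrow> p \<in> points \<Longrightarrow>
    action (g \<otimes>\<^bsub>SB3\<^esub> h) p = action g (action h p)"
  by (simp add: action.hom_mult BijGroup_mult_apply)

lemma action_points: "g \<in> carrier SB3 \<Longrightarrow> p \<in> points \<Longrightarrow> action g p \<in> points"
  by (simp add: BijGroup_apply_closed)

lemma action_one [simp]: "p \<in> points \<Longrightarrow> action \<one>\<^bsub>SB3\<^esub> p = p"
  by (simp add: action.hom_one)

lemma action_inv:
  assumes "g \<in> carrier SB3" "p \<in> points" "action g p = p'"
  shows "action (inv\<^bsub>SB3\<^esub> g) p' = p"
  using assms action_mult[of "inv\<^bsub>SB3\<^esub> g" g p] by simp

section \<open>Evaluating normal forms\<close>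

lemma point_val_closed: "p \<in> points \<Longrightarrow> point_val p \<in> carrier SB3"
  by (cases p) auto

lemma SB3_int_pow_Suc: "\<sigma>1 [^]\<^bsub>SB3\<^esub> (n + 1 :: int) = \<sigma>1 \<otimes>\<^bsub>SB3\<^esub> \<sigma>1 [^]\<^bsub>SB3\<^esub> n"
  by (metis SB.int_pow_1 SB.int_pow_mult add.commute sb3_gen_closed(1))

text \<open>Checks the rows of \<open>act\<close> inside \<open>SB3\<close>. The rows for
  \<open>\<tau>1\<close> outside \<open>Q0\<close> rest on \<open>\<sigma>2^-1 \<tau>1 \<sigma>2 =
  \<sigma>1 \<tau>2 \<sigma>1^-1\<close>; the shift of the exponent for \<open>\<sigma>2\<close> on
  \<open>Q2\<close> comes from \<open>\<sigma>2 \<sigma>1 \<sigma>2 k = \<sigma>1 \<sigma>2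
  \<sigma>1 k = \<sigma>1 \<sigma>2 (twist k) \<sigma>1\<close>.\<close>

lemma point_val_act:
  assumes "p \<in> points"
  shows "point_val (act x p) = pres_gen UNIV sb3_rels x \<otimes>\<^bsub>SB3\<^esub> point_val p"
proof (cases p)
  case (fields q k n)
  then have "k \<in> carrier HP" using assms by simp
  then show ?thesis
    unfolding fields
    by (cases x; cases q; simp add: emb_gen SB3_int_pow_Suc emb_twist_left SB.m_assoc
        flip: \<sigma>1_def \<sigma>2_def \<tau>1_def \<tau>2_def; simp add: braid_simps)
qed

lemma carrier_SB3: "carrier SB3 = generate SB3 (range (pres_gen UNIV sb3_rels))"
  unfolding SB3_def by (rule carrier_presented_group)

lemma point_val_action:
  assumes "g \<in> carrier SB3" "p \<in> points"
  shows "point_val (action g p) = g \<otimes>\<^bsub>SB3\<^esub> point_val p"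
proof -
  have gen: "pres_gen UNIV sb3_rels x \<in> carrier SB3" for x
    by (simp add: SB3_def)
  have g: "g \<in> generate SB3 (range (pres_gen UNIV sb3_rels))"
    using assms(1) by (simp add: carrier_SB3)
  then show ?thesis
    using assms(2)
  proof (induction arbitrary: p rule: generate.induct)
    case one
    then show ?case by (simp add: point_val_closed)
  next
    case (incl h)
    then obtain x where "h = pres_gen UNIV sb3_rels x" by auto
    then show ?case using point_val_act incl.prems by (simp add: action_pres_gen)
  next
    case (inv h)
    then obtain x where h: "h = pres_gen UNIV sb3_rels x" by auto
    have hc: "h \<in> carrier SB3" by (simp add: h gen)
    \<comment> \<open>The case of a generator is applied at the preimage of \<open>p\<close>, after
      which \<open>h\<close> cancels.\<close>
    define p' where "p' = action (inv\<^bsub>SB3\<^esub> h) p"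
    have p': "p' \<in> points" unfolding p'_def using inv hc by (simp add: action_points)
    have "action h p' = p"
      unfolding p'_def using inv hc by (simp add: action_mult[symmetric])
    then have "point_val p = h \<otimes>\<^bsub>SB3\<^esub> point_val p'"
      using point_val_act[OF p', of x] p' by (simp add: h action_pres_gen)
    then show ?case
      using hc p' by (simp add: p'_def[symmetric] point_val_closed)
  next
    case (eng a b)
    then have "a \<in> carrier SB3" "b \<in> carrier SB3" by (simp_all add: carrier_SB3)
    then show ?case
      using eng by (simp add: action_mult action_points point_val_closed SB.m_assoc)
  qed
qed

text \<open>The base point \<open>(Q0, \<one>, 0)\<close> evaluates to 1, so by equivariance
  \<open>g\<close> moves it to a point with value \<open>g\<close>.\<close>

lemma SB3_normal_form:
  assumes "g \<in> carrier SB3"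
  obtains q k n where "k \<in> carrier HP" "g = point_val (q, k, n)"
proof -
  have "point_val (Q0, \<one>\<^bsub>HP\<^esub>, 0) = \<one>\<^bsub>SB3\<^esub>" by simp
  then have "g = point_val (action g (Q0, \<one>\<^bsub>HP\<^esub>, 0))"
    using assms point_val_action[of g "(Q0, \<one>\<^bsub>HP\<^esub>, 0)"] by simp
  moreover have "action g (Q0, \<one>\<^bsub>HP\<^esub>, 0) \<in> points" using assms by (simp add: action_points)
  ultimately show ?thesis using that by (cases "action g (Q0, \<one>\<^bsub>HP\<^esub>, 0)") auto
qed

section \<open>Faithfulness on the trivial coset\<close>

lemma action_sigma2_inv:
  "k \<in> carrier HP \<Longrightarrow> action (inv\<^bsub>SB3\<^esub> \<sigma>2) (Q0, k, n) = (Q1, inv\<^bsub>HP\<^esub> hg A23 \<otimes>\<^bsub>HP\<^esub> k, n)"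
  by (rule action_inv) (simp_all add: action_gen)

text \<open>On \<open>Q0\<close> the abstract group acts by its left regular representation. The
  image of the base point therefore recovers the element, which is what makes \<open>emb\<close>
  injective.\<close>

lemma action_emb:
  assumes "h \<in> carrier HP" "k \<in> carrier HP"
  shows "action (emb h) (Q0, k, n) = (Q0, h \<otimes>\<^bsub>HP\<^esub> k, n)"
proof -
  \<comment> \<open>For \<open>a13\<close> and \<open>c13\<close> the path leaves \<open>Q0\<close>
    through \<open>\<sigma>2^-1\<close> and comes back through \<open>\<sigma>2\<close>; for
    \<open>a13\<close> it picks up \<open>A23 * twist A23 * A23^-1 = A13\<close>, and likewise
    \<open>C13\<close> for \<open>c13\<close>.\<close>
  have gen: "action (emb (hg x)) (Q0, k, n) = (Q0, hg x \<otimes>\<^bsub>HP\<^esub> k, n)"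
    if "k \<in> carrier HP" for x k n
    using that
    by (cases x) (simp_all add: emb_gen a13_def a23_def c12_def c13_def c23_def numeral_2_eq_2
        action_mult action_gen action_sigma2_inv action_points HP.m_assoc)
  have HP: "generate HP (range hg) = carrier HP"
    using carrier_presented_group[of h_gens h_rels] by (simp add: HP_def hg_def h_gens_UNIV)
  with assms(1) have "h \<in> generate HP (range hg)" by simp
  then show ?thesis
    using assms(2)
  proof (induction arbitrary: k rule: generate.induct)
    case one
    then show ?case by (simp)
  next
    case (incl h)
    then show ?case using gen by auto
  next
    case (inv h)
    then obtain x where h: "h = hg x" by auto
    have "action (inv\<^bsub>SB3\<^esub> emb h) (Q0, k, n) = (Q0, inv\<^bsub>HP\<^esub> h \<otimes>\<^bsub>HP\<^esub> k, n)"
      using inv by (intro action_inv) (simp_all add: h gen)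
    then show ?case by (simp add: h)
  next
    case (eng a b)
    then have "a \<in> carrier HP" "b \<in> carrier HP" by (simp_all add: HP)
    then show ?case using eng by (simp add: action_mult HP.m_assoc)
  qed
qed

lemma emb_inj: "inj_on emb (carrier HP)"
proof (rule inj_onI)
  fix h h' assume h: "h \<in> carrier HP" "h' \<in> carrier HP" and eq: "emb h = emb h'"
  have "action (emb x) (Q0, \<one>\<^bsub>HP\<^esub>, 0) = (Q0, x, 0)" if "x \<in> carrier HP" for x
    using that by (simp add: action_emb)
  from this[OF h(1)] this[OF h(2)] show "h = h'" unfolding eq by simp
qed

text \<open>\<open>twist\<close> fixes the identity, so here \<open>\<sigma>1\<close> moves only the
  exponent. This detects the order of \<open>\<sigma>1\<close> and separates its powers from
  \<open>H\<close>.\<close>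

lemma action_sigma1_pow:
  "action (\<sigma>1 [^]\<^bsub>SB3\<^esub> (m::int)) (Q0, \<one>\<^bsub>HP\<^esub>, n) = (Q0, \<one>\<^bsub>HP\<^esub>, n + m)"
proof (induction m rule: int_induct[where k = 0])
  case base
  then show ?case by simp
next
  case (step1 i)
  then show ?case
    by (simp add: SB3_int_pow_Suc action_mult action_gen)
next
  case (step2 i)
  have "\<sigma>1 [^]\<^bsub>SB3\<^esub> (i - 1) = inv\<^bsub>SB3\<^esub> \<sigma>1 \<otimes>\<^bsub>SB3\<^esub> \<sigma>1 [^]\<^bsub>SB3\<^esub> i"
    using SB.int_pow_mult[of \<sigma>1 "- 1" i] SB.int_pow_neg[of \<sigma>1 1] by simp
  moreover have "action (inv\<^bsub>SB3\<^esub> \<sigma>1) (Q0, \<one>\<^bsub>HP\<^esub>, n + i) = (Q0, \<one>\<^bsub>HP\<^esub>, n + (i - 1))"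
    by (rule action_inv) (simp_all add: action_gen)
  ultimately show ?case using step2(2) by (simp only: action_mult SB.inv_closed SB.int_pow_closed sb3_gen_closed points_iff HP.one_closed)
qed

section \<open>The presentations\<close>

lemma emb_image: "emb ` carrier HP = generate SB3 {a13, a23, c12, c13, c23}"
proof -
  have HP: "carrier HP = generate HP (range hg)"
    unfolding HP_def hg_def h_gens_UNIV by (rule carrier_presented_group)
  have "range hg \<subseteq> carrier HP" by auto
  then have "emb ` generate HP (range hg) = generate SB3 (emb ` range hg)"
    by (rule emb.generate_img[symmetric])
  then have "emb ` carrier HP = generate SB3 (emb ` range hg)"
    by (simp only: HP)
  also have "emb ` range hg = h_elem ` h_gens"
    by (simp add: image_image emb_gen h_gens_UNIV)
  finally show ?thesis by (simp add: h_gens_def)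
qed

lemma H_presentation:
  "has_presentation (SB3\<lparr>carrier := generate SB3 {a13, a23, c12, c13, c23}\<rparr>) h_gens h_elem h_rels"
proof -
  have "has_presentation (SB3\<lparr>carrier := generate SB3 (h_elem ` h_gens)\<rparr>) h_gens h_elem h_rels"
    by (rule has_presentation_generate[OF SB.is_group emb_hom[unfolded HP_def]
          emb_gen[unfolded hg_def] emb_inj[unfolded HP_def]])
  then show ?thesis by (simp add: h_gens_def)
qed

text \<open>Killing \<open>c\<^sub>1\<^sub>2\<close> retracts \<open>H\<close> onto the abstract base group, which therefore embeds in \<open>H\<close>.\<close>

lemma base_presentation:
  "has_presentation (SB3\<lparr>carrier := generate SB3 {a13, a23, c13, c23}\<rparr>) base_gens h_elem base_rels"
proof -
  define i where "i = pres_hom base_gens base_rels HP hg"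
  have "hg ` base_gens \<subseteq> carrier HP" by auto
  note i = HP.base_pres_hom[OF this hg_rels(1,2), folded i_def]
  define v where "v x = (if x = C12 then \<one>\<^bsub>BP\<^esub> else bg x)" for x
  define r where "r = pres_hom h_gens h_rels BP v"
  have v_closed: "v x \<in> carrier BP" for x
    by (cases x) (auto simp: v_def)
  \<comment> \<open>Once \<open>C12\<close> becomes trivial, its relation reads
    \<open>A13 A23 = A13 A23\<close>, because the associated isomorphism is the identity.\<close>
  have "v A13 \<otimes>\<^bsub>BP\<^esub> v C13 = v C13 \<otimes>\<^bsub>BP\<^esub> v A13" "v A23 \<otimes>\<^bsub>BP\<^esub> v C23 = v C23 \<otimes>\<^bsub>BP\<^esub> v A23"
    "v C12 \<otimes>\<^bsub>BP\<^esub> (v A13 \<otimes>\<^bsub>BP\<^esub> v A23) = v A13 \<otimes>\<^bsub>BP\<^esub> (v A23 \<otimes>\<^bsub>BP\<^esub> v C12)"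
    by (simp_all add: v_def bg_rels)
  note r = BP.h_pres_hom[of v, OF v_closed this, folded r_def]
  have "inj_on i (carrier BP)"
  proof (rule inj_on_inverseI)
    have "r (i (bg x)) = bg x" if "x \<in> base_gens" for x
      using that by (auto simp: i r v_def base_gens_def)
    then show "r (i b) = b" if "b \<in> carrier BP" for b
      using presented_group_left_inverse[of i base_gens base_rels HP r b] that i(1) r(1)
      by (simp add: BP_def bg_def)
  qed
  then have inj: "inj_on (emb \<circ> i) (carrier BP)"
    using inj_on_subset[OF emb_inj hom_carrier[OF i(1)]] by (rule comp_inj_on)
  have gen: "(emb \<circ> i) (bg x) = h_elem x" if "x \<in> base_gens" for x
    using that by (simp add: i emb_gen)
  have "has_presentation (SB3\<lparr>carrier := generate SB3 (h_elem ` base_gens)\<rparr>) base_gens h_elem base_rels"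
    by (rule has_presentation_generate[OF SB.is_group hom_compose[OF i(1) emb_hom, unfolded BP_def]
          gen[unfolded bg_def] inj[unfolded BP_def]])
  then show ?thesis by (simp add: base_gens_def)
qed

text \<open>\<open>P\<close> has every element of \<open>G\<close> as a letter, yet it need only be
  compared with the finite presentation: \<open>\<psi>\<close> maps \<open>HP\<close> onto
  \<open>P\<close>, and \<open>\<phi>\<close> after \<open>\<psi>\<close> is the injective
  \<open>emb\<close>, which forces \<open>\<phi>\<close> to be injective.\<close>

lemma HNN_presentation:
  fixes G
  defines "G \<equiv> generate SB3 {a13, a23, c13, c23}"
  shows "has_presentation (SB3\<lparr>carrier := generate SB3 {a13, a23, c12, c13, c23}\<rparr>)
    (hnn_gens (SB3\<lparr>carrier := G\<rparr>)) (case_sum (\<lambda>g. g) (\<lambda>_. c12))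
    (hnn_rels (SB3\<lparr>carrier := G\<rparr>) (generate SB3 {a13 \<otimes>\<^bsub>SB3\<^esub> a23}) (\<lambda>x. x))"
proof -
  let ?B = "{a13, a23, c13, c23}"
  define A where "A = generate SB3 {a13 \<otimes>\<^bsub>SB3\<^esub> a23}"
  define S where "S = hnn_gens (SB3\<lparr>carrier := G\<rparr>)"
  define R where "R = hnn_rels (SB3\<lparr>carrier := G\<rparr>) A (\<lambda>x. x)"
  define v where "v = (case_sum (\<lambda>g. g) (\<lambda>_. c12) :: sb3_gen letter list set + unit \<Rightarrow> _)"
  define P where "P = presented_group S R"
  define g where "g = pres_gen S R"
  note elem = elem_closed
  have G: "subgroup G SB3"
    unfolding G_def using elem by (intro SB.generate_is_subgroup) auto
  interpret G: group "SB3\<lparr>carrier := G\<rparr>" by (rule SB.subgroup_imp_group[OF G])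
  interpret P: group P unfolding P_def by (rule group_presented_group)
  have S: "S = insert (Inr ()) (Inl ` G)" by (simp add: S_def hnn_gens_def)
  have BG: "a13 \<in> G" "a23 \<in> G" "c13 \<in> G" "c23 \<in> G" unfolding G_def by (auto intro: generate.incl)
  have GSB: "G \<subseteq> carrier SB3" by (rule subgroup.subset[OF G])
  have AG: "A \<subseteq> G"
    unfolding A_def using BG subgroup.m_closed[OF G] by (intro SB.generate_subgroup_incl[OF _ G]) auto
  have g_closed: "g x \<in> carrier P" if "x \<in> S" for x
    using that unfolding g_def P_def by auto
  have Inl_hom: "(\<lambda>x. g (Inl x)) \<in> hom (SB3\<lparr>carrier := G\<rparr>) P"
    unfolding g_def P_def by (rule hom_of_table_rels[OF _ _ G.is_group]) (auto simp: R_def hnn_rels_def S)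
  have Inl_mult: "g (Inl (x \<otimes>\<^bsub>SB3\<^esub> y)) = g (Inl x) \<otimes>\<^bsub>P\<^esub> g (Inl y)" if "x \<in> G" "y \<in> G" for x y
    using hom_mult[OF Inl_hom] that by simp
  have commute: "c12 \<otimes>\<^bsub>SB3\<^esub> a = a \<otimes>\<^bsub>SB3\<^esub> c12" if a: "a \<in> A" for a
  proof -
    \<comment> \<open>\<open>A\<close> is cyclic, so it is enough that \<open>c12\<close> commutes
      with its generator \<open>a13 a23\<close>.\<close>
    obtain n :: int where "a = (a13 \<otimes>\<^bsub>SB3\<^esub> a23) [^]\<^bsub>SB3\<^esub> n"
      using a SB.generate_pow[OF SB.m_closed[OF elem(1,2)]] by (auto simp: A_def)
    moreover have "c12 \<otimes>\<^bsub>SB3\<^esub> (a13 \<otimes>\<^bsub>SB3\<^esub> a23) = a13 \<otimes>\<^bsub>SB3\<^esub> a23 \<otimes>\<^bsub>SB3\<^esub> c12"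
      by (simp add: braid_simps)
    ultimately show ?thesis using SB.int_pow_commute[of "a13 \<otimes>\<^bsub>SB3\<^esub> a23" c12 n] elem by simp
  qed
  have v_closed: "v ` S \<subseteq> carrier SB3"
    using GSB elem by (auto simp: S v_def)
  have v_rels: "word_val SB3 v s = word_val SB3 v t" if "(s, t) \<in> R" for s t
  proof -
    from that consider x y where "x \<in> G" "y \<in> G"
        "s = [pos (Inl x), pos (Inl y)]" "t = [pos (Inl (x \<otimes>\<^bsub>SB3\<^esub> y))]"
      | a where "a \<in> A" "s = [pos (Inr ()), pos (Inl a), neg (Inr ())]" "t = [pos (Inl a)]"
      by (auto simp: R_def hnn_rels_def table_rels_iff)
    then show ?thesis
    proof cases
      case 1
      then show ?thesis using GSB by (simp add: v_def subset_iff)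
    next
      case 2
      then have "a \<in> carrier SB3" using GSB AG by auto
      then have "c12 \<otimes>\<^bsub>SB3\<^esub> (a \<otimes>\<^bsub>SB3\<^esub> inv\<^bsub>SB3\<^esub> c12) = a \<otimes>\<^bsub>SB3\<^esub> c12 \<otimes>\<^bsub>SB3\<^esub> inv\<^bsub>SB3\<^esub> c12"
        using elem commute[OF 2(1)] by (metis SB.inv_closed SB.m_assoc)
      also have "\<dots> = a" using \<open>a \<in> carrier SB3\<close> elem by (simp add: SB.m_assoc)
      finally show ?thesis using \<open>a \<in> carrier SB3\<close> elem by (simp add: 2 v_def)
    qed
  qed
  define \<phi> where "\<phi> = pres_hom S R SB3 v"
  have \<phi>: "\<phi> \<in> hom P SB3"
    unfolding \<phi>_def P_def by (rule SB.pres_hom_hom[OF v_closed v_rels])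
  have \<phi>_gen: "\<phi> (g x) = v x" if "x \<in> S" for x
    unfolding \<phi>_def g_def by (rule SB.pres_hom_gen[OF v_closed v_rels that])
  define w where "w = case_h_gen (g (Inl a13)) (g (Inl a23)) (g (Inr ())) (g (Inl c13)) (g (Inl c23))"
  have w_closed: "w x \<in> carrier P" for x
    by (cases x) (auto simp: w_def S BG intro: g_closed)
  have t_rel: "g (Inr ()) \<otimes>\<^bsub>P\<^esub> (g (Inl a13) \<otimes>\<^bsub>P\<^esub> g (Inl a23)) = g (Inl a13) \<otimes>\<^bsub>P\<^esub> (g (Inl a23) \<otimes>\<^bsub>P\<^esub> g (Inr ()))"
  proof -
    let ?d = "a13 \<otimes>\<^bsub>SB3\<^esub> a23"
    have dA: "?d \<in> A" unfolding A_def by (rule generate.incl) simp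
    have dG: "?d \<in> G" using dA AG by auto
    have "word_val P g [pos (Inr ()), pos (Inl ?d), neg (Inr ())] = word_val P g [pos (Inl ?d)]"
      unfolding P_def g_def using dA dG by (intro pres_gen_relation) (auto simp: R_def hnn_rels_def S)
    then have "g (Inr ()) \<otimes>\<^bsub>P\<^esub> g (Inl ?d) \<otimes>\<^bsub>P\<^esub> inv\<^bsub>P\<^esub> g (Inr ()) = g (Inl ?d)"
      using g_closed dG by (simp add: S P.m_assoc)
    then have "g (Inr ()) \<otimes>\<^bsub>P\<^esub> g (Inl ?d) = g (Inl ?d) \<otimes>\<^bsub>P\<^esub> g (Inr ())"
      using g_closed dG by (metis P.inv_closed P.inv_solve_right' P.m_closed S imageI insertI1 insertI2 P.inv_inv)
    then show ?thesis using g_closed BG by (simp add: Inl_mult S P.m_assoc)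
  qed
  define \<psi> where "\<psi> = pres_hom h_gens h_rels P w"
  have w_rels: "w A13 \<otimes>\<^bsub>P\<^esub> w C13 = w C13 \<otimes>\<^bsub>P\<^esub> w A13" "w A23 \<otimes>\<^bsub>P\<^esub> w C23 = w C23 \<otimes>\<^bsub>P\<^esub> w A23"
    "w C12 \<otimes>\<^bsub>P\<^esub> (w A13 \<otimes>\<^bsub>P\<^esub> w A23) = w A13 \<otimes>\<^bsub>P\<^esub> (w A23 \<otimes>\<^bsub>P\<^esub> w C12)"
    \<comment> \<open>The two commutations are products inside \<open>G\<close>: the table relations
      fold each side into one letter, and the braid relations show that the letters agree.\<close>
    unfolding w_def h_gen.case using t_rel BG
    by (simp_all add: Inl_mult[symmetric] t_rel) (simp_all add: braid_simps)
  have \<psi>: "\<psi> \<in> hom HP P" "\<And>x. \<psi> (hg x) = w x"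
    unfolding \<psi>_def using P.h_pres_hom[of w, OF w_closed w_rels] by simp_all
  interpret \<psi>: group_hom HP P \<psi> by unfold_locales (rule \<psi>(1))
  interpret Inl: group_hom "SB3\<lparr>carrier := G\<rparr>" P "\<lambda>x. g (Inl x)" by unfold_locales (rule Inl_hom)
  have img: "subgroup (\<psi> ` carrier HP) P" by (rule \<psi>.img_is_subgroup)
  have w_img: "w x \<in> \<psi> ` carrier HP" for x using \<psi>(2)[of x] by (metis hg_closed imageI)
  \<comment> \<open>The table relations make \<open>Inl\<close> a homomorphism on \<open>G\<close>,
    so reaching the letters of the four generators of \<open>G\<close> reaches all of them.\<close>
  have "(\<lambda>x. g (Inl x)) ` G \<subseteq> \<psi> ` carrier HP"
  proof -
    have "?B \<subseteq> G" using BG by simp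
    then have "generate (SB3\<lparr>carrier := G\<rparr>) ?B = G"
      unfolding G_def by (rule SB.generate_consistent[OF _ G[unfolded G_def]])
    moreover have "generate P ((\<lambda>x. g (Inl x)) ` ?B) = (\<lambda>x. g (Inl x)) ` generate (SB3\<lparr>carrier := G\<rparr>) ?B"
      using BG by (intro Inl.generate_img) simp
    ultimately have "(\<lambda>x. g (Inl x)) ` G = generate P ((\<lambda>x. g (Inl x)) ` ?B)"
      by (simp only:)
    also have "\<dots> \<subseteq> \<psi> ` carrier HP"
      using w_img[of A13] w_img[of A23] w_img[of C13] w_img[of C23]
      by (intro P.generate_subgroup_incl[OF _ img]) (auto simp: w_def)
    finally show ?thesis .
  qed
  then have "g ` S \<subseteq> \<psi> ` carrier HP" using w_img[of C12] by (auto simp: S w_def)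
  then have "generate P (g ` S) \<subseteq> \<psi> ` carrier HP"
    by (rule P.generate_subgroup_incl[OF _ img])
  then have \<psi>_surj: "carrier P \<subseteq> \<psi> ` carrier HP"
    unfolding P_def g_def carrier_presented_group[of S R, symmetric] .
  have v_w: "\<phi> (w x) = h_elem x" for x
    using BG by (cases x) (simp_all add: w_def \<phi>_gen S v_def)
  have \<phi>\<psi>: "\<phi> (\<psi> k) = emb k" if "k \<in> carrier HP" for k
    using hom_eq_on_presented_group[OF SB.is_group hom_compose[OF \<psi>(1) \<phi>, unfolded HP_def]
        emb_hom[unfolded HP_def]] that \<psi>(2) emb_gen v_w by (simp add: HP_def hg_def)
  have inj: "inj_on \<phi> (carrier P)"
  proof (rule inj_onI)
    fix p q assume "p \<in> carrier P" "q \<in> carrier P" and eq: "\<phi> p = \<phi> q"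
    then obtain k l where kl: "k \<in> carrier HP" "l \<in> carrier HP" "p = \<psi> k" "q = \<psi> l"
      using \<psi>_surj by blast
    then have "emb k = emb l" using eq \<phi>\<psi> by simp
    then show "p = q" using emb_inj kl by (simp add: inj_on_eq_iff)
  qed
  have "generate SB3 (v ` S) = generate SB3 {a13, a23, c12, c13, c23}"
  proof
    have H: "subgroup (generate SB3 {a13, a23, c12, c13, c23}) SB3"
      using elem by (intro SB.generate_is_subgroup) auto
    have "G \<subseteq> generate SB3 {a13, a23, c12, c13, c23}"
      unfolding G_def by (rule SB.mono_generate) auto
    then have "v ` S \<subseteq> generate SB3 {a13, a23, c12, c13, c23}"
      by (auto simp: S v_def intro: generate.incl)
    then show "generate SB3 (v ` S) \<subseteq> generate SB3 {a13, a23, c12, c13, c23}"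
      by (rule SB.generate_subgroup_incl[OF _ H])
    have "{a13, a23, c12, c13, c23} \<subseteq> v ` S" using BG by (auto simp: S v_def image_image)
    then show "generate SB3 {a13, a23, c12, c13, c23} \<subseteq> generate SB3 (v ` S)"
      by (rule SB.mono_generate)
  qed
  moreover have "has_presentation (SB3\<lparr>carrier := generate SB3 (v ` S)\<rparr>) S v R"
    by (rule has_presentation_generate[OF SB.is_group \<phi>[unfolded P_def]
          \<phi>_gen[unfolded g_def] inj[unfolded P_def]])
  ultimately show ?thesis
    unfolding v_def S_def R_def A_def by simp
qed

section \<open>The semidirect product decomposition\<close>

lemma a12_pow: "a12 [^]\<^bsub>SB3\<^esub> (n::int) = \<sigma>1 [^]\<^bsub>SB3\<^esub> (2 * n)"
proof -
  have a12: "a12 = \<sigma>1 [^]\<^bsub>SB3\<^esub> (2::int)"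
    using int_pow_int[of SB3 \<sigma>1 2] by (simp add: a12_def)
  show ?thesis unfolding a12 by (simp add: SB.int_pow_pow)
qed

text \<open>Applied to the base point, the left side changes only the component in \<open>HP\<close>
  and the right side only the exponent.\<close>

lemma emb_eq_sigma1_pow:
  assumes "k \<in> carrier HP" "emb k = \<sigma>1 [^]\<^bsub>SB3\<^esub> (n::int)"
  shows "n = 0"
proof -
  have "(Q0, k, 0) = action (emb k) (Q0, \<one>\<^bsub>HP\<^esub>, 0)" using assms(1) by (simp add: action_emb)
  also have "\<dots> = (Q0, \<one>\<^bsub>HP\<^esub>, n)" unfolding assms(2) action_sigma1_pow by simp
  finally show ?thesis by simp
qed

lemma sigma1_pow_inj: "\<sigma>1 [^]\<^bsub>SB3\<^esub> (m::int) = \<sigma>1 [^]\<^bsub>SB3\<^esub> (n::int) \<Longrightarrow> m = n"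
  by (metis action_sigma1_pow add_0 prod.inject)

lemma U2_iso_integers: "SB3\<lparr>carrier := generate SB3 {a12}\<rparr> \<cong> integer_group"
proof -
  have a: "a12 \<in> carrier SB3" by (simp add: a12_def)
  have "(\<lambda>n. a12 [^]\<^bsub>SB3\<^esub> n) \<in> iso integer_group (SB3\<lparr>carrier := generate SB3 {a12}\<rparr>)"
  proof (rule isoI)
    show "(\<lambda>n. a12 [^]\<^bsub>SB3\<^esub> n) \<in> hom integer_group (SB3\<lparr>carrier := generate SB3 {a12}\<rparr>)"
      using a by (auto intro!: homI simp: SB.int_pow_mult SB.generate_pow)
    have "inj (\<lambda>n::int. a12 [^]\<^bsub>SB3\<^esub> n)"
      by (rule injI) (auto simp: a12_pow dest: sigma1_pow_inj)
    then show "bij_betw (\<lambda>n::int. a12 [^]\<^bsub>SB3\<^esub> n) (carrier integer_group)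
        (carrier (SB3\<lparr>carrier := generate SB3 {a12}\<rparr>))"
      using a by (auto simp: bij_betw_def SB.generate_pow)
  qed
  then have "integer_group \<cong> SB3\<lparr>carrier := generate SB3 {a12}\<rparr>"
    unfolding is_iso_def by blast
  then show ?thesis by (rule group.iso_sym[OF group_integer_group])
qed

text \<open>\<open>\<sigma>1\<close> normalizes the image of \<open>emb\<close>:
  \<open>twist\<close> serves the upward steps and \<open>untwist\<close> the downward ones. The
  existential form avoids iterated twists.\<close>

lemma sigma1_pow_emb:
  assumes "k \<in> carrier HP"
  shows "\<exists>l\<in>carrier HP. \<sigma>1 [^]\<^bsub>SB3\<^esub> (n::int) \<otimes>\<^bsub>SB3\<^esub> emb k = emb l \<otimes>\<^bsub>SB3\<^esub> \<sigma>1 [^]\<^bsub>SB3\<^esub> n"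
proof (induction n rule: int_induct[where k = 0])
  case base
  show ?case by (rule bexI[of _ k]) (use assms in simp_all)
next
  case (step1 n)
  then obtain l where l: "l \<in> carrier HP"
    "\<sigma>1 [^]\<^bsub>SB3\<^esub> n \<otimes>\<^bsub>SB3\<^esub> emb k = emb l \<otimes>\<^bsub>SB3\<^esub> \<sigma>1 [^]\<^bsub>SB3\<^esub> n" by blast
  have "\<sigma>1 [^]\<^bsub>SB3\<^esub> (n + 1) \<otimes>\<^bsub>SB3\<^esub> emb k
      = \<sigma>1 \<otimes>\<^bsub>SB3\<^esub> (\<sigma>1 [^]\<^bsub>SB3\<^esub> n \<otimes>\<^bsub>SB3\<^esub> emb k)"
    using assms by (simp add: SB3_int_pow_Suc SB.m_assoc)
  also have "\<dots> = emb (twist l) \<otimes>\<^bsub>SB3\<^esub> \<sigma>1 [^]\<^bsub>SB3\<^esub> (n + 1)"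
    unfolding l(2) SB3_int_pow_Suc using l(1) by (intro emb_twist_left[symmetric]) auto
  finally show ?case by (rule bexI) (use l(1) in simp)
next
  case (step2 n)
  then obtain l where l: "l \<in> carrier HP"
    "\<sigma>1 [^]\<^bsub>SB3\<^esub> n \<otimes>\<^bsub>SB3\<^esub> emb k = emb l \<otimes>\<^bsub>SB3\<^esub> \<sigma>1 [^]\<^bsub>SB3\<^esub> n" by blast
  let ?p = "\<sigma>1 [^]\<^bsub>SB3\<^esub> (n - 1)"
  have n: "\<sigma>1 [^]\<^bsub>SB3\<^esub> n = \<sigma>1 \<otimes>\<^bsub>SB3\<^esub> ?p"
    using SB3_int_pow_Suc[of "n - 1"] by simp
  have "\<sigma>1 \<otimes>\<^bsub>SB3\<^esub> (?p \<otimes>\<^bsub>SB3\<^esub> emb k) = \<sigma>1 \<otimes>\<^bsub>SB3\<^esub> ?p \<otimes>\<^bsub>SB3\<^esub> emb k"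
    using assms by (simp add: SB.m_assoc)
  also have "\<dots> = emb (twist (untwist l)) \<otimes>\<^bsub>SB3\<^esub> (\<sigma>1 \<otimes>\<^bsub>SB3\<^esub> ?p)"
    unfolding n[symmetric] using l by simp
  also have "\<dots> = \<sigma>1 \<otimes>\<^bsub>SB3\<^esub> (emb (untwist l) \<otimes>\<^bsub>SB3\<^esub> ?p)"
    using l(1) by (intro emb_twist_left) auto
  finally have "?p \<otimes>\<^bsub>SB3\<^esub> emb k = emb (untwist l) \<otimes>\<^bsub>SB3\<^esub> ?p"
    using assms l(1) by simp
  then show ?case by (rule bexI) (use l(1) in simp)
qed

lemma ST3_semidirect:
  fixes \<pi> :: "sb3_gen letter list set \<Rightarrow> nat \<Rightarrow> nat"
  assumes "\<pi> \<in> hom SB3 (sym_group 3)"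
    and \<pi>: "\<pi> \<sigma>1 = transpose 1 2" "\<pi> \<sigma>2 = transpose 2 3" "\<pi> \<tau>1 = id" "\<pi> \<tau>2 = id"
  shows "is_semidirect_product (ST3 \<pi>) (generate SB3 {a13, a23, c12, c13, c23}) (generate SB3 {a12})"
proof -
  let ?K = "kernel SB3 (sym_group 3) \<pi>"
  interpret \<pi>: group_hom SB3 "sym_group 3" \<pi>
    using assms(1) sym_group_is_group SB.is_group by (simp add: group_hom_def group_hom_axioms_def)
  have one: "\<one>\<^bsub>sym_group 3\<^esub> = id" and mult: "\<And>p q. p \<otimes>\<^bsub>sym_group 3\<^esub> q = p \<circ> q"
    by (simp_all add: sym_group_def)
  have K: "subgroup ?K SB3" by (rule \<pi>.subgroup_kernel)
  interpret ST: group "ST3 \<pi>" unfolding ST3_def by (rule SB.subgroup_imp_group[OF K])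
  have K_iff: "g \<in> ?K \<longleftrightarrow> g \<in> carrier SB3 \<and> \<pi> g = id" for g
    by (simp add: kernel_def one)
  have pow2: "\<pi> (\<sigma>1 [^]\<^bsub>SB3\<^esub> (2::nat)) = id" "\<pi> (\<sigma>2 [^]\<^bsub>SB3\<^esub> (2::nat)) = id"
    by (simp_all add: numeral_2_eq_2 \<pi> mult)
  have conj: "\<sigma>2 \<otimes>\<^bsub>SB3\<^esub> g \<otimes>\<^bsub>SB3\<^esub> inv\<^bsub>SB3\<^esub> \<sigma>2 \<in> ?K" if "g \<in> ?K" for g
    using normal.inv_op_closed2[OF \<pi>.normal_kernel, of \<sigma>2 g] that by simp
  have a12: "a12 \<in> ?K" using pow2 by (simp add: K_iff a12_def)
  have "{a13, a23, c12, c13, c23} \<subseteq> ?K"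
    using conj[of "\<sigma>1 [^]\<^bsub>SB3\<^esub> (2::nat)"] conj[of \<tau>1] pow2 \<pi>
    by (auto simp: a13_def a23_def c12_def c13_def c23_def K_iff)
  then have HK: "emb ` carrier HP \<subseteq> ?K"
    unfolding emb_image by (rule SB.generate_subgroup_incl[OF _ K])
  have UK: "generate SB3 {a12} \<subseteq> ?K"
    using a12 by (intro SB.generate_subgroup_incl[OF _ K]) simp
  have H: "subgroup (emb ` carrier HP) SB3" by (rule emb.img_is_subgroup)
  have a12_closed: "a12 \<in> carrier SB3" by (simp add: a12_def)
  have U: "subgroup (generate SB3 {a12}) SB3"
    using a12_closed by (intro SB.generate_is_subgroup) simp
  have U_iff: "u \<in> generate SB3 {a12} \<longleftrightarrow> (\<exists>n::int. u = a12 [^]\<^bsub>SB3\<^esub> n)" for u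
    using a12_closed by (auto simp: SB.generate_pow)
  have dec: "\<exists>k\<in>carrier HP. \<exists>n::int. x = emb k \<otimes>\<^bsub>SB3\<^esub> a12 [^]\<^bsub>SB3\<^esub> n" if x: "x \<in> ?K" for x
  proof -
    obtain q k m where k: "k \<in> carrier HP" and xeq: "x = point_val (q, k, m)"
      using SB3_normal_form[of x] x K_iff by metis
    \<comment> \<open>In the even case \<open>n\<close> is the exponent of \<open>a12\<close>; the
      odd case is ruled out below by the permutation of \<open>x\<close>.\<close>
    obtain n where m: "m = 2 * n \<or> m = 2 * n + 1" by (metis oddE evenE)
    have \<pi>n: "\<pi> (a12 [^]\<^bsub>SB3\<^esub> n) = id" using UK U_iff K_iff by blast
    have s: "\<pi> (\<sigma>1 [^]\<^bsub>SB3\<^esub> m) = (if even m then id else transpose 1 2)"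
      using m \<pi>n by (auto simp: a12_pow SB3_int_pow_Suc \<pi> mult)
    have "\<pi> (emb k) = id" using HK k K_iff by blast
    then have px: "\<pi> (coset_rep q) \<circ> \<pi> (\<sigma>1 [^]\<^bsub>SB3\<^esub> m) = id"
      using x k unfolding xeq K_iff by (simp add: mult)
    \<comment> \<open>Evaluation at 3 detects the coset: powers of \<open>\<sigma>1\<close> fix 3,
      whereas the representatives of \<open>Q1\<close> and \<open>Q2\<close> move it.\<close>
    have "\<pi> (\<sigma>1 [^]\<^bsub>SB3\<^esub> m) 3 = 3" by (simp add: s transpose_def)
    then have "\<pi> (coset_rep q) 3 = 3" using fun_cong[OF px, of 3] by simp
    then have "q = Q0" by (cases q) (simp_all add: \<pi> mult transpose_def)
    \<comment> \<open>Evaluation at 1 detects the parity of \<open>m\<close>, as the transposition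
      of 1 and 2 moves 1.\<close>
    moreover from this have "\<pi> (\<sigma>1 [^]\<^bsub>SB3\<^esub> m) 1 = 1"
      using fun_cong[OF px, of 1] by (simp add: one)
    then have "even m" by (simp add: s transpose_def split: if_splits)
    ultimately show ?thesis
      using k m xeq by (intro bexI[of _ k] exI[of _ n]) (auto simp: a12_pow)
  qed
  have "emb ` carrier HP \<lhd> ST3 \<pi>"
  proof (rule ST.normal_invI)
    show "subgroup (emb ` carrier HP) (ST3 \<pi>)"
      unfolding ST3_def by (rule SB.subgroup_incl[OF H K HK])
    fix x h assume "x \<in> carrier (ST3 \<pi>)" "h \<in> emb ` carrier HP"
    then obtain k where xK: "x \<in> ?K" and k: "k \<in> carrier HP" "h = emb k" by (auto simp: ST3_def)
    from dec[OF xK] obtain l and n :: int where l: "l \<in> carrier HP"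
      and x: "x = emb l \<otimes>\<^bsub>SB3\<^esub> a12 [^]\<^bsub>SB3\<^esub> n" by blast
    obtain j where j: "j \<in> carrier HP"
      "a12 [^]\<^bsub>SB3\<^esub> n \<otimes>\<^bsub>SB3\<^esub> h = emb j \<otimes>\<^bsub>SB3\<^esub> a12 [^]\<^bsub>SB3\<^esub> n"
      using sigma1_pow_emb[OF k(1), of "2 * n"] by (auto simp: a12_pow k)
    have hc: "h \<in> carrier SB3" using k by simp
    have "x \<otimes>\<^bsub>SB3\<^esub> h \<otimes>\<^bsub>SB3\<^esub> inv\<^bsub>SB3\<^esub> x
        = emb l \<otimes>\<^bsub>SB3\<^esub> (a12 [^]\<^bsub>SB3\<^esub> n \<otimes>\<^bsub>SB3\<^esub> h) \<otimes>\<^bsub>SB3\<^esub> inv\<^bsub>SB3\<^esub> x"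
      using l hc a12_closed by (simp add: x SB.m_assoc)
    \<comment> \<open>The power of \<open>a12\<close> on the right of \<open>emb j\<close> cancels
      against the one in the inverse of \<open>x\<close>, leaving a conjugate within the image of
      \<open>emb\<close>.\<close>
    also have "\<dots> = emb (l \<otimes>\<^bsub>HP\<^esub> j \<otimes>\<^bsub>HP\<^esub> inv\<^bsub>HP\<^esub> l)"
      unfolding j(2) using l j(1) a12_closed by (simp add: x SB.m_assoc SB.inv_mult_group)
    finally have "x \<otimes>\<^bsub>SB3\<^esub> h \<otimes>\<^bsub>SB3\<^esub> inv\<^bsub>SB3\<^esub> x \<in> emb ` carrier HP"
      by (rule image_eqI) (use l j in simp)
    then show "x \<otimes>\<^bsub>ST3 \<pi>\<^esub> h \<otimes>\<^bsub>ST3 \<pi>\<^esub> inv\<^bsub>ST3 \<pi>\<^esub> x \<in> emb ` carrier HP"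
      unfolding ST3_def using SB.m_inv_consistent[OF K xK] by simp
  qed
  moreover have "subgroup (generate SB3 {a12}) (ST3 \<pi>)"
    unfolding ST3_def by (rule SB.subgroup_incl[OF U K UK])
  moreover have "emb ` carrier HP \<inter> generate SB3 {a12} = {\<one>\<^bsub>ST3 \<pi>\<^esub>}"
  proof -
    have "x = \<one>\<^bsub>SB3\<^esub>" if x: "x \<in> emb ` carrier HP" "x \<in> generate SB3 {a12}" for x
    proof -
      obtain k where k: "k \<in> carrier HP" "x = emb k" using x(1) by blast
      obtain n :: int where n: "x = \<sigma>1 [^]\<^bsub>SB3\<^esub> (2 * n)"
        using x(2) unfolding U_iff a12_pow by blast
      have "2 * n = 0" by (rule emb_eq_sigma1_pow[OF k(1)]) (simp only: k(2)[symmetric] n)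
      then show ?thesis unfolding n by (simp only: int_pow_0)
    qed
    then have "emb ` carrier HP \<inter> generate SB3 {a12} = {\<one>\<^bsub>SB3\<^esub>}"
      using subgroup.one_closed[OF H] subgroup.one_closed[OF U] by blast
    moreover have "\<one>\<^bsub>ST3 \<pi>\<^esub> = \<one>\<^bsub>SB3\<^esub>" by (simp add: ST3_def)
    ultimately show ?thesis by (simp only:)
  qed
  moreover have "emb ` carrier HP <#>\<^bsub>ST3 \<pi>\<^esub> generate SB3 {a12} = carrier (ST3 \<pi>)"
  proof
    show "emb ` carrier HP <#>\<^bsub>ST3 \<pi>\<^esub> generate SB3 {a12} \<subseteq> carrier (ST3 \<pi>)"
      using HK UK subgroup.m_closed[OF K] by (auto simp: set_mult_def ST3_def)
    show "carrier (ST3 \<pi>) \<subseteq> emb ` carrier HP <#>\<^bsub>ST3 \<pi>\<^esub> generate SB3 {a12}"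
    proof
      fix x assume "x \<in> carrier (ST3 \<pi>)"
      then have "x \<in> ?K" by (simp add: ST3_def)
      from dec[OF this] obtain k and n :: int where k: "k \<in> carrier HP"
        and x: "x = emb k \<otimes>\<^bsub>SB3\<^esub> a12 [^]\<^bsub>SB3\<^esub> n" by blast
      have "a12 [^]\<^bsub>SB3\<^esub> n \<in> generate SB3 {a12}" unfolding U_iff by blast
      with k show "x \<in> emb ` carrier HP <#>\<^bsub>ST3 \<pi>\<^esub> generate SB3 {a12}"
        unfolding x set_mult_def ST3_def by auto
    qed
  qed
  ultimately show ?thesis unfolding is_semidirect_product_def emb_image by blast
qed

theorem theorem4p1:
  fixes \<pi> :: "sb3_gen letter list set \<Rightarrow> nat \<Rightarrow> nat"
  assumes "\<pi> \<in> hom SB3 (sym_group 3)"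
    and "\<pi> \<sigma>1 = transpose 1 2" and "\<pi> \<sigma>2 = transpose 2 3"
    and "\<pi> \<tau>1 = id" and "\<pi> \<tau>2 = id"
  shows "let H = generate SB3 {a13, a23, c12, c13, c23};
             U2 = generate SB3 {a12};
             G = generate SB3 {a13, a23, c13, c23};
             A = generate SB3 {a13 \<otimes>\<^bsub>SB3\<^esub> a23};
             Z2 = integer_group \<times>\<times> integer_group
         in is_semidirect_product (ST3 \<pi>) H U2
          \<and> has_presentation (SB3\<lparr>carrier := H\<rparr>) h_gens h_elem h_rels
          \<and> SB3\<lparr>carrier := U2\<rparr> \<cong> integer_group
          \<and> is_HNN_extension (SB3\<lparr>carrier := H\<rparr>) G c12 A A (\<lambda>x. x)
          \<and> has_presentation (SB3\<lparr>carrier := G\<rparr>) base_gens h_elem base_rels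
          \<and> free_product Z2 Z2 \<cong> presented_group base_gens base_rels"
proof -
  let ?H = "generate SB3 {a13, a23, c12, c13, c23}"
  let ?G = "generate SB3 {a13, a23, c13, c23}"
  let ?A = "generate SB3 {a13 \<otimes>\<^bsub>SB3\<^esub> a23}"
  note elem = elem_closed
  have H: "subgroup ?H SB3" and G: "subgroup ?G SB3" and A: "subgroup ?A SB3"
    using elem by (auto intro!: SB.generate_is_subgroup)
  have "?G \<subseteq> ?H" by (rule SB.mono_generate) auto
  moreover have "?A \<subseteq> ?G"
    by (intro SB.generate_subgroup_incl[OF _ G]) (auto intro: generate.intros)
  moreover have "c12 \<in> ?H" by (auto intro: generate.incl)
  ultimately have "is_HNN_extension (SB3\<lparr>carrier := ?H\<rparr>) ?G c12 ?A ?A (\<lambda>x. x)"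
    unfolding is_HNN_extension_def
    using SB.subgroup_imp_group[OF H] SB.subgroup_incl[OF G H] SB.subgroup_incl[OF A G]
      HNN_presentation iso_set_refl by simp
  then show ?thesis
    using ST3_semidirect[OF assms] H_presentation U2_iso_integers base_presentation
      free_product_Z2_Z2_iso by (simp add: Let_def)
qed

end
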